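(* Let $f(w,q)$ be a (real- or complex-valued) function defined for $q\in[0,1]$ and depending on a parameter $w$, integrable in $q$ over $[0,1]$, with Fourier expansion $$f(w,q)=a_0(w)+\sum_{n=1}^{\infty}\bigl(a_n(w)\cos(2\pi qn)+b_n(w)\sin(2\pi qn)\bigr),$$ so that, for $n\ge 1$, $$a_n(w)=2\int_0^1 f(w,q)\cos(2\pi qn)\,dq,\qquad b_n(w)=2\int_0^1 f(w,q)\sin(2\pi qn)\,dq ,$$ and $a_0(w)=\int_0^1 f(w,q)\,dq$. Then, for every real $z\le 0$, $$\int_0^1 f(w,q)\,\zeta(z,q)\,dq=\frac{\Gamma(1-z)}{(2\pi)^{1-z}}\left(\sin\Bigl(\frac{\pi z}{2}\Bigr)\sum_{n=1}^{\infty}\frac{a_n(w)}{n^{1-z}}+\cos\Bigl(\frac{\pi z}{2}\Bigr)\sum_{n=1}^{\infty}\frac{b_n(w)}{n^{1-z}}\right)$$ and $$\int_0^1 f(w,q)\,\zeta(z,1-q)\,dq=\frac{\Gamma(1-z)}{(2\pi)^{1-z}}\left(\sin\Bigl(\frac{\pi z}{2}\Bigr)\sum_{n=1}^{\infty}\frac{a_n(w)}{n^{1-z}}-\cos\Bigl(\frac{\pi z}{2}\Bigr)\sum_{n=1}^{\infty}\frac{b_n(w)}{n^{1-z}}\right).$$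
   Context: $\zeta(z,q)$ denotes the Hurwitz zeta function: for $q>0$ it is $\sum_{n=0}^{\infty}(n+q)^{-z}$ when $\mathrm{Re}(z)>1$, extended by analytic continuation in $z$ to $\mathbb{C}\setminus\{1\}$. "Fourier expansion" means that the coefficients are given by the displayed integral formulas. Infinite series are limits of partial sums. At $z=0$ the term carrying the factor $\sin(\pi z/2)=0$ is read as $0$. *)

theory Defs
  imports "HOL-Complex_Analysis.Complex_Analysis"
begin

(* For q > 0, hurwitz_zeta z q is the Hurwitz zeta function: the analytic continuation
   to C - {1} of the series of (n + q)^(-z), Re z > 1.  Since C - {1} is connected, the
   identity theorem makes the chosen F unique on C - {1}.  The value at z = 1 is
   arbitrary, and the function is only meaningful for q > 0. *)
definition hurwitz_zeta :: "complex \<Rightarrow> real \<Rightarrow> complex" where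
  "hurwitz_zeta z q =
     (SOME F. F holomorphic_on (- {1}) \<and>
        (\<forall>s. Re s > 1 \<longrightarrow>
           (\<lambda>n. (of_nat n + complex_of_real q) powr (- s)) sums F s)) z"

end

theory Submission
  imports Defs
begin

text \<open>
  For \<open>0 < q < 1\<close>, the Euler--Maclaurin formula continues \<open>\<zeta>(s, q)\<close> to \<open>Re s > -1\<close>, whereas Hurwitz's
  trigonometric series is holomorphic on \<open>Re s < 0\<close>. On the common strip it suffices to compare
  them at \<open>s = -p\<close> with \<open>0 < p < 1\<close>, where both are continuous periodic functions of \<open>q\<close>. The Fourier
  coefficients of the first are found by Abel regularization: damping \<open>(n + q)\<^sup>p\<close> by
  \<open>exp (- \<epsilon> (n + q))\<close> unfolds the integral over one period into a Gamma integral over the half-line.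
  So the two pieces glue to the analytic continuation, and Hurwitz's series represents \<open>\<zeta>(z, q)\<close>
  for every real \<open>z < 0\<close>; at \<open>z = 0\<close> it becomes the sawtooth series of \<open>1/2 - q\<close>. In all cases its
  partial sums are uniformly bounded on \<open>(0, 1)\<close>, so it may be multiplied by the integrable \<open>f\<close>
  and integrated termwise by dominated convergence.
\<close>

text \<open>The obstacle is that the sum of (n + q)^p diverges, so its Fourier coefficients cannot
  be computed termwise. Damping makes the sum finite. What blows up as the damping vanishes is the
  half-line integral, which is constant in q: subtracting it changes only the zeroth coefficient,
  and there the two contributions cancel exactly. The trapezoid form has a remainder bounded
  independently of the damping, so the limit may be taken under both the sum and the integral.
  Euler-Maclaurin starts at q + 1, with q^(-s) kept apart, so that its estimates stay uniform down
  to q = 0 and the closed period [0, 1] is available. At z = 0 the sine series converges only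
  conditionally and has no summable majorant; an explicit Dirichlet-kernel estimate takes its place.
  There the sum of a_n / n may diverge for an integrable f, while convergence of the sum of b_n / n
  is itself a by-product of dominated convergence.\<close>

section \<open>Error of the trapezoid rule\<close>

text \<open>The defect of the trapezoid rule on [x, t] has as derivative in t half the linearization
  error of \<open>f\<close> at t, so repeated use of the mean value inequality suffices. That
  inequality holds in every normed space, where Taylor's theorem with an intermediate point fails.
  The constant is crude; only the order matters.\<close>

lemma trapezoid_error:
  fixes F f f' f'' :: "real \<Rightarrow> 'a::real_normed_vector"
  assumes F: "\<And>t. t \<in> {x..x+1} \<Longrightarrow> (F has_vector_derivative f t) (at t)"
    and f: "\<And>t. t \<in> {x..x+1} \<Longrightarrow> (f has_vector_derivative f' t) (at t)"
    and f': "\<And>t. t \<in> {x..x+1} \<Longrightarrow> (f' has_vector_derivative f'' t) (at t)"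
    and B: "\<And>t. t \<in> {x..x+1} \<Longrightarrow> norm (f'' t) \<le> B"
  shows "norm ((1/2) *\<^sub>R (f x + f (x + 1)) - (F (x + 1) - F x)) \<le> B"
proof -
  have B0: "0 \<le> B" by (rule order_trans[OF norm_ge_zero B[of x]]) simp
  have f'_diff: "norm (f' u - f' t) \<le> B" if "u \<in> {x..x+1}" "t \<in> {x..x+1}" for u t
  proof -
    have "norm (f' u - f' t) \<le> B * norm (u - t)"
    proof (rule differentiable_bound[of "{x..x+1}" f' "\<lambda>t h. h *\<^sub>R f'' t"])
      show "(f' has_derivative (\<lambda>h. h *\<^sub>R f'' t)) (at t within {x..x+1})" if "t \<in> {x..x+1}" for t
        using f'[OF that] has_vector_derivative_at_within unfolding has_vector_derivative_def
        by (blast intro: has_derivative_at_withinI)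
      show "onorm (\<lambda>h. h *\<^sub>R f'' t) \<le> B" if "t \<in> {x..x+1}" for t
        using B[OF that] by (intro onorm_le) (simp add: mult.commute[of B] mult_left_mono)
    qed (use that in auto)
    also have "\<dots> \<le> B * 1" using that B0 by (intro mult_left_mono) auto
    finally show ?thesis by simp
  qed
  have lin: "norm (f x - f t - (x - t) *\<^sub>R f' t) \<le> B" if "t \<in> {x..x+1}" for t
  proof -
    have "norm (f x - f t - (x - t) *\<^sub>R f' t) \<le> norm (x - t) * B"
      using that f f'_diff
      by (intro vector_differentiable_bound_linearization[of "{x..x+1}"])
         (auto simp: closed_segment_eq_real_ivl intro: has_vector_derivative_at_within)
    also have "\<dots> \<le> 1 * B" using that B0 by (intro mult_right_mono) auto
    finally show ?thesis by simp
  qed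
  define \<phi> where "\<phi> t = ((t - x) / 2) *\<^sub>R (f x + f t) - F t" for t
  define \<phi>' where "\<phi>' t = (1/2) *\<^sub>R (f x + f t) + ((t - x) / 2) *\<^sub>R f' t - f t" for t
  have \<phi>_deriv: "(\<phi> has_vector_derivative \<phi>' t) (at t within {x..x+1})" if "t \<in> {x..x+1}" for t
  proof -
    have "((\<lambda>t. (t - x) / 2) has_field_derivative (1 - 0)/2) (at t within {x..x+1})"
      by (intro DERIV_cdivide DERIV_diff DERIV_ident DERIV_const)
    moreover have "((\<lambda>t. f x + f t) has_vector_derivative 0 + f' t) (at t within {x..x+1})"
      by (intro has_vector_derivative_add has_vector_derivative_const has_vector_derivative_at_within[OF f[OF that]])
    ultimately have "((\<lambda>t. ((t - x) / 2) *\<^sub>R (f x + f t)) has_vector_derivative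
        ((t - x) / 2) *\<^sub>R (0 + f' t) + ((1 - 0)/2) *\<^sub>R (f x + f t)) (at t within {x..x+1})"
      by (rule has_vector_derivative_scaleR)
    from has_vector_derivative_diff[OF this has_vector_derivative_at_within[OF F[OF that]]]
    show ?thesis unfolding \<phi>_def \<phi>'_def by (simp add: add.commute)
  qed
  have \<phi>'_bound: "norm (\<phi>' t) \<le> B" if "t \<in> {x..x+1}" for t
  proof -
    have "\<phi>' t = (1/2) *\<^sub>R (f x + f t) + ((t - x) / 2) *\<^sub>R f' t - (1/2) *\<^sub>R (f t + f t)"
      by (simp add: \<phi>'_def)
    also have "\<dots> = (1/2) *\<^sub>R (f x - f t - (x - t) *\<^sub>R f' t)"
      by (simp add: scaleR_diff_right scaleR_add_right diff_divide_distrib scaleR_diff_left)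
    finally have "norm (\<phi>' t) = (1/2) * norm (f x - f t - (x - t) *\<^sub>R f' t)" by simp
    also have "\<dots> \<le> 1 * B" using lin[OF that] by (intro mult_mono) auto
    finally show ?thesis by simp
  qed
  have "norm (\<phi> (x + 1) - \<phi> x) \<le> B * norm (x + 1 - x)"
  proof (rule differentiable_bound[of "{x..x+1}" \<phi> "\<lambda>t h. h *\<^sub>R \<phi>' t"])
    show "(\<phi> has_derivative (\<lambda>h. h *\<^sub>R \<phi>' t)) (at t within {x..x+1})" if "t \<in> {x..x+1}" for t
      using \<phi>_deriv[OF that] unfolding has_vector_derivative_def .
    show "onorm (\<lambda>h. h *\<^sub>R \<phi>' t) \<le> B" if "t \<in> {x..x+1}" for t
      using \<phi>'_bound[OF that] by (intro onorm_le) (simp add: mult.commute[of B] mult_left_mono)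
  qed auto
  then show ?thesis by (simp add: \<phi>_def algebra_simps)
qed

section \<open>Gamma integrals with a complex rate\<close>

lemma has_integral_Gamma_rate_real:
  fixes u b :: real
  assumes u: "u > 0" and b: "b > 0"
  shows "((\<lambda>x. x powr (u - 1) * exp (- (b * x))) has_integral (Gamma u * b powr (- u))) {0..}"
proof -
  let ?f = "\<lambda>t::real. ennreal (indicator {0..} t * t powr (u - 1) / exp t)"
  let ?g = "\<lambda>x::real. if x \<in> {0..} then x powr (u - 1) * exp (- (b * x)) else 0"
  have "ennreal (Gamma u) = nn_integral lborel ?f"
    by (rule Gamma_conv_nn_integral_real) fact
  also have "\<dots> = ennreal b * (\<integral>\<^sup>+x. ?f (0 + b * x) \<partial>lborel)"
    using nn_integral_real_affine[of ?f b 0] b by simp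
  also have "(\<integral>\<^sup>+x. ?f (0 + b * x) \<partial>lborel) = (\<integral>\<^sup>+x. ennreal (b powr (u - 1)) * ennreal (?g x) \<partial>lborel)"
    using b by (intro nn_integral_cong)
      (auto simp: indicator_def zero_le_mult_iff powr_mult exp_minus divide_inverse mult_ac simp flip: ennreal_mult)
  also have "\<dots> = ennreal (b powr (u - 1)) * (\<integral>\<^sup>+x. ennreal (?g x) \<partial>lborel)"
    by (intro nn_integral_cmult) measurable
  finally have "ennreal (Gamma u) = ennreal (b powr u) * (\<integral>\<^sup>+x. ennreal (?g x) \<partial>lborel)"
    using b by (simp add: mult.assoc[symmetric] powr_diff flip: ennreal_mult)
  then have "ennreal (b powr (- u)) * ennreal (Gamma u)
      = (ennreal (b powr (- u)) * ennreal (b powr u)) * (\<integral>\<^sup>+x. ennreal (?g x) \<partial>lborel)"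
    by (simp add: mult.assoc)
  also have "ennreal (b powr (- u)) * ennreal (b powr u) = 1"
    using b by (simp flip: ennreal_mult powr_add)
  finally have "(\<integral>\<^sup>+x. ennreal (?g x) \<partial>lborel) = ennreal (Gamma u * b powr (- u))"
    using u Gamma_real_pos[OF u] by (simp add: mult.commute flip: ennreal_mult)
  then have "(?g has_integral (Gamma u * b powr (- u))) UNIV"
    using Gamma_real_pos[OF u]
    by (intro nn_integral_has_integral) auto
  then show ?thesis by (subst (asm) has_integral_restrict_UNIV)
qed

text \<open>Reduction to a real rate: write \<open>exp (- a x) = exp (- R x) * exp ((R - a) x)\<close> for real \<open>R\<close>
  with \<open>norm (R - a) < R\<close>, expand the second factor, integrate termwise, and resum by the
  binomial series.\<close>

lemma has_integral_Gamma_rate_complex: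
  fixes u :: real and a :: complex
  assumes u: "u > 0" and a: "Re a > 0"
  shows "((\<lambda>x. complex_of_real (x powr (u - 1)) * exp (- (a * of_real x))) has_integral
            (of_real (Gamma u) * a powr (- of_real u))) {0..}"
proof -
  \<comment> \<open>Any real R > |a|^2 / (2 Re a) satisfies |R - a| < R; this choice gives |c|^2 =
    R^2 - |a|^2.\<close>
  define R where "R = (norm a)\<^sup>2 / Re a"
  define c where "c = of_real R - a"
  have a0: "a \<noteq> 0" using a by auto
  have R: "R > 0" using a a0 by (simp add: R_def)
  have "(norm c)\<^sup>2 = R\<^sup>2 - 2 * R * Re a + (norm a)\<^sup>2"
    unfolding c_def cmod_power2 by (simp add: power2_eq_square algebra_simps)
  also have "\<dots> = R\<^sup>2 - (norm a)\<^sup>2" using a by (simp add: R_def)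
  also have "\<dots> < R\<^sup>2" using a0 by simp
  finally have cR: "norm c < R" using R by (meson less_eq_real_def power_less_imp_less_base)
  define f where "f k x = (\<Sum>n<k. complex_of_real (x powr (u - 1)) * exp (- of_real (R * x)) * ((c * of_real x) ^ n /\<^sub>R fact n))" for k x
  define y where "y k = (\<Sum>n<k. of_real (Gamma u * R powr (- u)) * (((- of_real u) gchoose n) * (- c / of_real R) ^ n))" for k
  show ?thesis
  \<comment> \<open>Every partial sum of exp (c x) is at most exp (|c| x) in norm, and |c| < R
    leaves an integrable real Gamma integrand.\<close>
  proof (rule has_integral_dominated_convergence[of f y _ "\<lambda>x. x powr (u - 1) * exp (- ((R - norm c) * x))"])
    fix k
    show "(f k has_integral y k) {0..}"
      unfolding f_def y_def
    proof (intro has_integral_sum)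
      fix n :: nat
      have "((\<lambda>x. x powr (u + n - 1) * exp (- (R * x))) has_integral (Gamma (u + n) * R powr (- (u + n)))) {0..}"
        using u R by (intro has_integral_Gamma_rate_real add_pos_nonneg) auto
      then have int: "((\<lambda>x. (c ^ n /\<^sub>R fact n) * complex_of_real (x powr (u + n - 1) * exp (- (R * x)))) has_integral
          (c ^ n /\<^sub>R fact n) * of_real (Gamma (u + n) * R powr (- (u + n)))) {0..}"
        by (intro has_integral_mult_right has_integral_of_real)
      have val: "(c ^ n /\<^sub>R fact n) * of_real (Gamma (u + n) * R powr (- (u + n))) =
          of_real (Gamma u * R powr (- u)) * (((- of_real u) gchoose n) * (- c / of_real R) ^ n)"
      proof -
        have "u \<notin> \<int>\<^sub>\<le>\<^sub>0" using nonpos_Ints_nonpos[of u] u by auto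
        then have 1: "Gamma (u + n) = pochhammer u n * Gamma u"
          using pochhammer_Gamma[of u n] Gamma_real_pos[OF u] by simp
        have 2: "R powr (- (u + n)) = R powr (-u) / R ^ n"
          using R by (simp add: powr_diff powr_realpow)
        have "((- complex_of_real u) gchoose n) * (- c / of_real R) ^ n =
            ((-1) ^ n * (-1) ^ n) * of_real (pochhammer u n) / fact n * (c / of_real R) ^ n"
          unfolding minus_divide_left[symmetric] power_minus[of "c / of_real R"]
          by (simp add: gbinomial_pochhammer pochhammer_of_real)
        also have "(c / of_real R) ^ n = c ^ n / of_real R ^ n" by (rule power_divide)
        also have "(-1) ^ n * (-1) ^ n = (1 :: complex)" using power_mult_distrib[of "-1 :: complex" "-1" n] by simp
        finally show ?thesis unfolding 1 2
          by (simp add: scaleR_conv_of_real power_divide divide_inverse mult_ac)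
      qed
      have eq: "(c ^ n /\<^sub>R fact n) * complex_of_real (x powr (u + n - 1) * exp (- (R * x))) =
           complex_of_real (x powr (u - 1)) * exp (- of_real (R * x)) * ((c * of_real x) ^ n /\<^sub>R fact n)"
        if "x > 0" for x
      proof -
        have "x powr (u + n - 1) = x powr (u - 1) * x ^ n"
          using that by (simp add: powr_add powr_diff powr_realpow)
        then show ?thesis
          by (simp add: scaleR_conv_of_real power_mult_distrib flip: exp_of_real)
      qed
      show "((\<lambda>x. complex_of_real (x powr (u - 1)) * exp (- of_real (R * x)) * ((c * of_real x) ^ n /\<^sub>R fact n)) has_integral
          of_real (Gamma u * R powr (- u)) * (((- of_real u) gchoose n) * (- c / of_real R) ^ n)) {0..}"
        unfolding val[symmetric]
        by (rule has_integral_spike[OF negligible_sing[of 0] _ int]) (rule eq[symmetric], auto)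
    qed auto
  next
    show "(\<lambda>x. x powr (u - 1) * exp (- ((R - norm c) * x))) integrable_on {0..}"
      using has_integral_Gamma_rate_real[OF u, of "R - norm c"] cR by auto
  next
    fix k
    show "\<forall>x\<in>{0..}. norm (f k x) \<le> x powr (u - 1) * exp (- ((R - norm c) * x))"
    proof
      fix x :: real assume "x \<in> {0..}"
      then have x: "x \<ge> 0" by simp
      have "norm (\<Sum>n<k. (c * of_real x) ^ n /\<^sub>R fact n) \<le> (\<Sum>n<k. (norm c * x) ^ n /\<^sub>R fact n)"
        using x by (intro sum_norm_le) (simp add: norm_power norm_mult)
      also have "\<dots> \<le> exp (norm c * x)"
        unfolding exp_def using x by (intro sum_le_suminf summable_exp_generic) auto
      finally have "x powr (u - 1) * exp (- (R * x)) * norm (\<Sum>n<k. (c * of_real x) ^ n /\<^sub>R fact n) \<le>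
           x powr (u - 1) * exp (- (R * x)) * exp (norm c * x)"
        by (intro mult_left_mono) auto
      then show "norm (f k x) \<le> x powr (u - 1) * exp (- ((R - norm c) * x))"
        unfolding f_def sum_distrib_left[symmetric]
        by (simp add: norm_mult mult.assoc left_diff_distrib flip: exp_add)
    qed
  next
    show "\<forall>x\<in>{0..}. (\<lambda>k. f k x) \<longlonglongrightarrow> complex_of_real (x powr (u - 1)) * exp (- (a * of_real x))"
    proof
      fix x :: real
      have "(\<lambda>n. (c * of_real x) ^ n /\<^sub>R fact n) sums exp (c * of_real x)"
        by (rule exp_converges)
      then have "(\<lambda>n. complex_of_real (x powr (u - 1)) * exp (- of_real (R * x)) * ((c * of_real x) ^ n /\<^sub>R fact n)) sums
          (complex_of_real (x powr (u - 1)) * exp (- of_real (R * x)) * exp (c * of_real x))"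
        by (rule sums_mult)
      moreover have "complex_of_real (x powr (u - 1)) * exp (- of_real (R * x)) * exp (c * of_real x) =
          complex_of_real (x powr (u - 1)) * exp (- (a * of_real x))"
        by (simp add: c_def mult.assoc algebra_simps flip: exp_add)
      ultimately show "(\<lambda>k. f k x) \<longlonglongrightarrow> complex_of_real (x powr (u - 1)) * exp (- (a * of_real x))"
        unfolding sums_def f_def by (simp only:)
    qed
  next
    have "norm (- c / of_real R) < 1" using cR R by (simp add: norm_divide)
    then have "(\<lambda>n. ((- of_real u) gchoose n) * (- c / of_real R) ^ n) sums (1 + (- c / of_real R)) powr (- of_real u)"
      by (rule gen_binomial_complex)
    then have "(\<lambda>n. of_real (Gamma u * R powr (- u)) * (((- of_real u) gchoose n) * (- c / of_real R) ^ n)) sums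
        (of_real (Gamma u * R powr (- u)) * (1 + (- c / of_real R)) powr (- of_real u))"
      by (rule sums_mult)
    moreover have "of_real (Gamma u * R powr (- u)) * (1 + (- c / of_real R)) powr (- of_real u) =
        of_real (Gamma u) * a powr (- of_real u)"
    proof -
      \<comment> \<open>Scaling by the positive real R respects the principal branch, so the power
        of a / R given by the binomial series becomes the power of a.\<close>
      have "1 + (- c / of_real R) = a / of_real R" using R by (simp add: c_def field_simps)
      moreover have "a powr (- of_real u) = (of_real R * (a / of_real R)) powr (- of_real u)" using R by simp
      moreover have "\<dots> = of_real R powr (- of_real u) * (a / of_real R) powr (- of_real u)"
        using R by (intro powr_times_real_left) auto
      ultimately show ?thesis using R powr_of_real[of R "-u"] by simp
    qed
    ultimately show "y \<longlonglongrightarrow> of_real (Gamma u) * a powr (- of_real u)"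
      unfolding sums_def y_def by (simp only:)
  qed
qed

section \<open>Fourier series of continuous periodic functions\<close>

text \<open>A trigonometric polynomial is encoded as a Laurent polynomial p(w) / w^N. The real
  Stone-Weierstrass theorem is applied to the ring of real functions of this form on the circle; Re
  and Im belong to it because conj w = 1 / w there, and together they separate points.\<close>

lemma Stone_Weierstrass_circle:
  fixes f :: "complex \<Rightarrow> real"
  assumes f: "continuous_on (sphere 0 1) f" and e: "e > 0"
  obtains p N where "\<And>w. norm w = 1 \<Longrightarrow> norm (of_real (f w) - poly p w / w ^ N) < e"
proof -
  define R where "R = {f. continuous_on (sphere (0::complex) 1) f \<and>
      (\<exists>p N. \<forall>w. norm w = 1 \<longrightarrow> complex_of_real (f w) = poly p w / w ^ N)}"
  interpret function_ring_on R "sphere 0 1"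
  proof
    fix f g assume "f \<in> R" "g \<in> R"
    then obtain p1 N1 p2 N2 where
      f: "continuous_on (sphere (0::complex) 1) f" "\<And>w. norm w = 1 \<Longrightarrow> complex_of_real (f w) = poly p1 w / w ^ N1"
      and g: "continuous_on (sphere (0::complex) 1) g" "\<And>w. norm w = 1 \<Longrightarrow> complex_of_real (g w) = poly p2 w / w ^ N2"
      unfolding R_def by blast
    have "complex_of_real (f w + g w) = poly (p1 * monom 1 N2 + p2 * monom 1 N1) w / w ^ (N1 + N2)" if "norm w = 1" for w
    proof -
      have "w \<noteq> 0" using that by auto
      then show ?thesis using f(2)[OF that] g(2)[OF that]
        by (simp add: poly_monom field_simps power_add)
    qed
    then have "\<exists>p N. \<forall>w. norm w = 1 \<longrightarrow> complex_of_real (f w + g w) = poly p w / w ^ N" by blast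
    then show "(\<lambda>x. f x + g x) \<in> R" unfolding R_def by (intro CollectI conjI continuous_on_add continuous_on_mult f(1) g(1))
    have "complex_of_real (f w * g w) = poly (p1 * p2) w / w ^ (N1 + N2)" if "norm w = 1" for w
      using f(2)[OF that] g(2)[OF that] by (simp add: power_add)
    then have "\<exists>p N. \<forall>w. norm w = 1 \<longrightarrow> complex_of_real (f w * g w) = poly p w / w ^ N" by blast
    then show "(\<lambda>x. f x * g x) \<in> R" unfolding R_def by (intro CollectI conjI continuous_on_add continuous_on_mult f(1) g(1))
  next
    fix c :: real
    have "complex_of_real c = poly [:of_real c:] w / w ^ 0" for w by simp
    then have "\<exists>p N. \<forall>w. norm w = 1 \<longrightarrow> complex_of_real c = poly p w / w ^ N" by blast
    then show "(\<lambda>_. c) \<in> R" unfolding R_def by (intro CollectI conjI continuous_on_const)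
  next
    fix x y :: complex assume "x \<in> sphere 0 1" "y \<in> sphere 0 1" "x \<noteq> y"
    have inv: "cnj w = 1 / w" if "norm w = 1" for w
    proof -
      have "w * cnj w = 1" using complex_norm_square[of w] that by simp
      moreover have "w \<noteq> 0" using that by auto
      ultimately show ?thesis by (simp add: eq_divide_eq mult.commute)
    qed
    have "complex_of_real (Re w) = poly [:1/2, 0, 1/2:] w / w ^ 1" if "norm w = 1" for w
    proof -
      have "w \<noteq> 0" using that by auto
      have "complex_of_real (Re w) = (w + cnj w) / 2" by (simp add: complex_eq_iff)
      also have "\<dots> = poly [:1/2, 0, 1/2:] w / w ^ 1" using \<open>w \<noteq> 0\<close> by (simp add: inv[OF that] field_simps)
      finally show ?thesis .
    qed
    then have "\<exists>p N. \<forall>w. norm w = 1 \<longrightarrow> complex_of_real (Re w) = poly p w / w ^ N" by blast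
    then have "Re \<in> R" unfolding R_def by (intro CollectI conjI continuous_on_Re continuous_on_id)
    have "complex_of_real (Im w) = poly [:\<i>/2, 0, -\<i>/2:] w / w ^ 1" if "norm w = 1" for w
    proof -
      have "w \<noteq> 0" using that by auto
      have "complex_of_real (Im w) = (cnj w - w) * \<i> / 2" by (simp add: complex_eq_iff)
      also have "\<dots> = poly [:\<i>/2, 0, -\<i>/2:] w / w ^ 1" using \<open>w \<noteq> 0\<close> by (simp add: inv[OF that] field_simps)
      finally show ?thesis .
    qed
    then have "\<exists>p N. \<forall>w. norm w = 1 \<longrightarrow> complex_of_real (Im w) = poly p w / w ^ N" by blast
    then have "Im \<in> R" unfolding R_def by (intro CollectI conjI continuous_on_Im continuous_on_id)
    show "\<exists>f\<in>R. f x \<noteq> f y"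
      using \<open>Re \<in> R\<close> \<open>Im \<in> R\<close> \<open>x \<noteq> y\<close> complex_eq_iff by blast
  qed (auto simp: R_def)
  obtain g where g: "g \<in> R" "\<forall>x\<in>sphere 0 1. \<bar>f x - g x\<bar> < e"
    using Stone_Weierstrass_basic[OF f e] by blast
  then obtain p N where pN: "\<And>w. norm w = 1 \<Longrightarrow> complex_of_real (g w) = poly p w / w ^ N"
    unfolding R_def by blast
  show thesis
  proof
    fix w :: complex assume w: "norm w = 1"
    have "complex_of_real (f w) - poly p w / w ^ N = of_real (f w - g w)"
      using pN[OF w] by simp
    then show "norm (complex_of_real (f w) - poly p w / w ^ N) < e"
      using g(2) w by (simp del: of_real_diff)
  qed
qed

text \<open>Since g 0 = g 1, g descends to a function k on the circle, whose real and imaginary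
  parts are approximated separately.\<close>

lemma trigonometric_polynomials_dense:
  fixes g :: "real \<Rightarrow> complex"
  assumes g: "continuous_on {0..1} g" and g01: "g 0 = g 1" and e: "e > 0"
  obtains p N where "\<And>q. q \<in> {0..1} \<Longrightarrow> norm (g q - poly p (cis (2 * pi * q)) / cis (2 * pi * q) ^ N) < e"
proof -
  define k where "k = g \<circ> (\<lambda>z. Arg2pi z / (2 * pi))"
  have "homotopic_loops (g ` {0..1}) g g"
    using g g01 by (simp add: homotopic_loops_refl path_def path_image_def pathstart_def pathfinish_def)
  then have "homotopic_with_canon (\<lambda>h. True) (sphere 0 1) (g ` {0..1}) k k"
    unfolding k_def by (rule homotopic_loops_imp_homotopic_circlemaps)
  then have k: "continuous_on (sphere 0 1) k"
    by (blast dest: homotopic_with_imp_continuous)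
  have k_cis: "k (cis (2 * pi * q)) = g q" if "q \<in> {0..1}" for q
  proof (cases "q = 1")
    case True
    then show ?thesis using g01 Arg2pi_of_real[of 1] by (simp add: k_def)
  next
    case False
    have "Arg2pi (cis (2 * pi * q)) = 2 * pi * q"
      using that False Arg2pi_exp[of "\<i> * of_real (2 * pi * q)"] by (simp add: cis_conv_exp)
    then show ?thesis by (simp add: k_def)
  qed
  have "continuous_on (sphere 0 1) (\<lambda>w. Re (k w))" "continuous_on (sphere 0 1) (\<lambda>w. Im (k w))"
    using k by (auto intro!: continuous_intros)
  then obtain p1 N1 p2 N2
    where p1: "\<And>w. norm w = 1 \<Longrightarrow> norm (of_real (Re (k w)) - poly p1 w / w ^ N1) < e/2"
      and p2: "\<And>w. norm w = 1 \<Longrightarrow> norm (of_real (Im (k w)) - poly p2 w / w ^ N2) < e/2"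
    using Stone_Weierstrass_circle[of _ "e/2"] e by (metis half_gt_zero)
  show thesis
  proof
    fix q :: real assume q: "q \<in> {0..1}"
    let ?w = "cis (2 * pi * q)"
    have w: "norm ?w = 1" "?w \<noteq> 0" by auto
    have "g q - poly (p1 * monom 1 N2 + [:\<i>:] * p2 * monom 1 N1) ?w / ?w ^ (N1 + N2) =
        (of_real (Re (k ?w)) - poly p1 ?w / ?w ^ N1) + \<i> * (of_real (Im (k ?w)) - poly p2 ?w / ?w ^ N2)"
    proof -
      have "g q = of_real (Re (k ?w)) + \<i> * of_real (Im (k ?w))"
        using k_cis[OF q] complex_eq by metis
      moreover have "poly (p1 * monom 1 N2 + [:\<i>:] * p2 * monom 1 N1) ?w / ?w ^ (N1 + N2) =
         poly p1 ?w / ?w ^ N1 + \<i> * (poly p2 ?w / ?w ^ N2)"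
        using w(2) by (simp add: poly_monom power_add divide_simps del: cis_neq_zero)
      ultimately show ?thesis by (simp add: algebra_simps)
    qed
    also have "norm \<dots> < e/2 + e/2"
      using p1[OF w(1)] p2[OF w(1)]
      by (intro norm_triangle_lt add_strict_mono) (auto simp: norm_mult)
    finally show "norm (g q - poly (p1 * monom 1 N2 + [:\<i>:] * p2 * monom 1 N1) ?w / ?w ^ (N1 + N2)) < e" by simp
  qed
qed

lemma poly_div_power_cis:
  "poly p (cis x) / cis x ^ N = (\<Sum>i\<le>degree p. coeff p i * cis (of_int (int i - int N) * x))"
  unfolding poly_altdef sum_divide_distrib
  by (intro sum.cong) (simp_all add: Complex.DeMoivre cis_divide algebra_simps flip: times_divide_eq_right)

text \<open>Let M bound |g| and let T be a trigonometric polynomial within e / M of conj g. The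
  integral of g T is 0, so that of |g|^2 equals the integral of g (conj g - T), which is at most e.
  As e is arbitrary, |g|^2 has integral 0, and continuity gives g = 0.\<close>

lemma Fourier_coefficients_unique:
  fixes g :: "real \<Rightarrow> complex"
  assumes g: "continuous_on {0..1} g" and g01: "g 0 = g 1"
    and coeff: "\<And>m::int. ((\<lambda>q. g q * cis (- (2 * pi * of_int m * q))) has_integral 0) {0..1}"
    and q: "q \<in> {0..1}"
  shows "g q = 0"
proof -
  have "compact (g ` {0..1})" using g by (intro compact_continuous_image) auto
  then obtain M where M: "M > 0" "\<And>q. q \<in> {0..1} \<Longrightarrow> norm (g q) \<le> M"
    using compact_imp_bounded bounded_pos by (metis imageI)
  have sq_int: "(\<lambda>q. (norm (g q))\<^sup>2) integrable_on {0..1}"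
    using g by (intro integrable_continuous_interval continuous_intros)
  have "integral {0..1} (\<lambda>q. (norm (g q))\<^sup>2) \<le> 0"
  proof (rule field_le_epsilon)
    fix e :: real assume "e > 0"
    then have e: "e / M > 0" using M by simp
    have "continuous_on {0..1} (\<lambda>q. cnj (g q))" "cnj (g 0) = cnj (g 1)"
      using g g01 by (auto intro!: continuous_intros)
    then obtain p N where pN: "\<And>q. q \<in> {0..1} \<Longrightarrow>
        norm (cnj (g q) - poly p (cis (2 * pi * q)) / cis (2 * pi * q) ^ N) < e / M"
      using trigonometric_polynomials_dense[of "\<lambda>q. cnj (g q)" "e / M"] e by metis
    let ?T = "\<lambda>q. poly p (cis (2 * pi * q)) / cis (2 * pi * q) ^ N"
    have "((\<lambda>q. \<Sum>i\<le>degree p. coeff p i * (g q * cis (- (2 * pi * of_int (int N - int i) * q)))) has_integral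
       (\<Sum>i\<le>degree p. coeff p i * 0)) {0..1}"
      by (intro has_integral_sum has_integral_mult_right assms(3)) auto
    then have "((\<lambda>q. g q * ?T q) has_integral 0) {0..1}"
      by (simp add: poly_div_power_cis sum_distrib_left algebra_simps)
    moreover have "((\<lambda>q. complex_of_real ((norm (g q))\<^sup>2)) has_integral of_real (integral {0..1} (\<lambda>q. (norm (g q))\<^sup>2))) {0..1}"
      using sq_int by (intro has_integral_of_real integrable_integral)
    ultimately have "((\<lambda>q. complex_of_real ((norm (g q))\<^sup>2) - g q * ?T q) has_integral
         of_real (integral {0..1} (\<lambda>q. (norm (g q))\<^sup>2)) - 0) {0..1}"
      by (intro has_integral_diff)
    then have "((\<lambda>q. g q * (cnj (g q) - ?T q)) has_integral
         of_real (integral {0..1} (\<lambda>q. (norm (g q))\<^sup>2))) {0..1}"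
      by (simp add: complex_norm_square right_diff_distrib del: of_real_power)
    moreover have "norm (g q * (cnj (g q) - ?T q)) \<le> e" if "q \<in> {0..1}" for q
    proof -
      have "norm (g q) * norm (cnj (g q) - ?T q) \<le> M * (e / M)"
        using pN[OF that] M that by (intro mult_mono) (auto intro: less_imp_le)
      then show ?thesis using M by (simp add: norm_mult)
    qed
    ultimately have "norm (complex_of_real (integral {0..1} (\<lambda>q. (norm (g q))\<^sup>2))) \<le> e * Henstock_Kurzweil_Integration.content {0..1::real}"
      using \<open>e > 0\<close> by (intro has_integral_bound_real[of e]) auto
    then show "integral {0..1} (\<lambda>q. (norm (g q))\<^sup>2) \<le> 0 + e" by simp
  qed
  moreover have "integral {0..1} (\<lambda>q. (norm (g q))\<^sup>2) \<ge> 0"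
    using sq_int by (intro integral_nonneg) auto
  ultimately have "((\<lambda>q. (norm (g q))\<^sup>2) has_integral 0) (cbox 0 1)"
    using sq_int by (metis antisym has_integral_integral interval_cbox)
  moreover have "continuous_on (cbox 0 1) (\<lambda>q. (norm (g q))\<^sup>2)"
    using continuous_on_power[OF continuous_on_norm[OF g]] by simp
  ultimately have "(norm (g q))\<^sup>2 = 0"
    using q by (intro has_integral_0_cbox_imp_0[of 0 1 "\<lambda>q. (norm (g q))\<^sup>2" q]) auto
  then show ?thesis by simp
qed

lemma has_integral_cis_period:
  fixes m :: int
  shows "((\<lambda>q. cis (2 * pi * of_int m * q)) has_integral (if m = 0 then 1 else 0)) {0..1}"
proof (cases "m = 0")
  case True
  then show ?thesis using has_integral_const_real[of "1::complex" 0 1] by simp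
next
  case False
  let ?c = "2 * pi * of_int m"
  have "((\<lambda>q. cis (?c * q)) has_integral (cis (?c * 1) / (\<i> * ?c) - cis (?c * 0) / (\<i> * ?c))) {0..1}"
  proof (rule fundamental_theorem_of_calculus)
    fix q :: real
    have "((\<lambda>z. exp (\<i> * ?c * z) / (\<i> * ?c)) has_field_derivative exp (\<i> * ?c * of_real q)) (at (of_real q))"
      using False by (auto intro!: derivative_eq_intros)
    then have "((\<lambda>q. exp (\<i> * ?c * of_real q) / (\<i> * ?c)) has_vector_derivative exp (\<i> * ?c * of_real q)) (at q within {0..1})"
      by (rule has_vector_derivative_real_field)
    then show "((\<lambda>q. cis (?c * q) / (\<i> * ?c)) has_vector_derivative cis (?c * q)) (at q within {0..1})"
      by (simp add: cis_conv_exp mult.assoc)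
  qed auto
  moreover have "cis ?c = 1" using cis_multiple_2pi[of "of_int m"] by simp
  ultimately show ?thesis using False by simp
qed

text \<open>By the M-test the series is continuous and has the coefficients c m, so its difference
  from g has only zero coefficients. The summand at n = 0 contains c 0 twice, which is why the mean
  is required to vanish.\<close>

lemma Fourier_series_absolutely_convergent:
  fixes g :: "real \<Rightarrow> complex" and c :: "int \<Rightarrow> complex"
  assumes g: "continuous_on {0..1} g" and g01: "g 0 = g 1"
    and coeff: "\<And>m::int. ((\<lambda>q. g q * cis (- (2 * pi * of_int m * q))) has_integral c m) {0..1}"
    and sum: "summable (\<lambda>n. norm (c (int n)))" "summable (\<lambda>n. norm (c (- int n)))"
    and c0: "c 0 = 0"
    and q: "q \<in> {0..1}"
  shows "g q = (\<Sum>n. c (int n) * cis (2 * pi * n * q) + c (- int n) * cis (- (2 * pi * n * q)))"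
proof -
  define t where "t n q = c (int n) * cis (2 * pi * n * q) + c (- int n) * cis (- (2 * pi * n * q))" for n q
  define M where "M n = norm (c (int n)) + norm (c (- int n))" for n
  have M: "summable M" unfolding M_def using sum by (rule summable_add)
  have t_le: "norm (t n q) \<le> M n" for n q
    unfolding t_def M_def by (rule order_trans[OF norm_triangle_ineq]) (simp add: norm_mult)
  have ul: "uniform_limit {0..1} (\<lambda>N q. \<Sum>n<N. t n q) (\<lambda>q. \<Sum>n. t n q) sequentially"
    using t_le M by (rule Weierstrass_m_test)
  have t_cont: "continuous_on A (t n)" for n A unfolding t_def by (intro continuous_intros)
  have cont: "continuous_on {0..1} (\<lambda>q. \<Sum>n. t n q)"
    by (rule uniform_limit_theorem[OF always_eventually ul]) (auto intro!: continuous_intros t_cont)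
  have "t n 0 = t n 1" for n
    using cis_multiple_2pi[of "of_nat n"] cis_multiple_2pi[of "- of_nat n"] by (simp add: t_def)
  then have t01: "(\<Sum>n. t n 0) = (\<Sum>n. t n 1)" by simp
  have "g q - (\<Sum>n. t n q) = 0"
  proof (rule Fourier_coefficients_unique[of "\<lambda>q. g q - (\<Sum>n. t n q)"])
    fix m :: int
    \<comment> \<open>The coefficient of frequency m in the n-th summand. Both conditions hold
      together only for n = m = 0, where c 0 = 0 makes the double count harmless.\<close>
    define y where "y n = (if int n = m then c m else 0) + (if - int n = m then c m else 0)" for n
    have "((\<lambda>q. t n q * cis (- (2 * pi * of_int m * q))) has_integral y n) {0..1}" for n
    proof -
      have "((\<lambda>q. c (int n) * cis (2 * pi * of_int (int n - m) * q) + c (- int n) * cis (2 * pi * of_int (- int n - m) * q))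
         has_integral (c (int n) * (if int n - m = 0 then 1 else 0) + c (- int n) * (if - int n - m = 0 then 1 else 0))) {0..1}"
        by (intro has_integral_add has_integral_mult_right has_integral_cis_period)
      moreover have "c (int n) * cis (2 * pi * of_int (int n - m) * q) + c (- int n) * cis (2 * pi * of_int (- int n - m) * q)
          = t n q * cis (- (2 * pi * of_int m * q))" for q
        by (simp add: t_def ring_distribs cis_mult mult.assoc)
      moreover have "c (int n) * (if int n - m = 0 then 1 else 0) = (if int n = m then c m else 0)"
        "c (- int n) * (if - int n - m = 0 then 1 else 0) = (if - int n = m then c m else 0)" by auto
      ultimately show ?thesis unfolding y_def by (simp only:)
    qed
    then have int_N: "((\<lambda>q. \<Sum>n<N. t n q * cis (- (2 * pi * of_int m * q))) has_integral (\<Sum>n<N. y n)) {0..1}" for N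
      by (intro has_integral_sum) auto
    have "y sums c m"
    proof -
      have "(\<lambda>n. (if n = nat m then if m \<ge> 0 then c m else 0 else 0) + (if n = nat (-m) then if m \<le> 0 then c m else 0 else 0)) sums
         ((if m \<ge> 0 then c m else 0) + (if m \<le> 0 then c m else 0))"
        by (intro sums_add sums_single)
      moreover have "y = (\<lambda>n. (if n = nat m then if m \<ge> 0 then c m else 0 else 0) + (if n = nat (-m) then if m \<le> 0 then c m else 0 else 0))"
        by (auto simp: y_def fun_eq_iff)
      ultimately show ?thesis using c0 by (cases "m = 0") (auto split: if_splits)
    qed
    have "((\<lambda>q. (\<Sum>n. t n q) * cis (- (2 * pi * of_int m * q))) has_integral c m) {0..1}"
    proof (rule has_integral_dominated_convergence[OF int_N, of "\<lambda>_. suminf M"])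
      show "\<forall>q\<in>{0..1}. norm (\<Sum>n<N. t n q * cis (- (2 * pi * of_int m * q))) \<le> suminf M" for N
      proof
        fix q :: real
        have "norm (\<Sum>n<N. t n q * cis (- (2 * pi * of_int m * q))) \<le> (\<Sum>n<N. M n)"
          using t_le by (intro sum_norm_le) (simp add: norm_mult)
        also have "\<dots> \<le> suminf M" by (intro sum_le_suminf M) (auto simp: M_def)
        finally show "norm (\<Sum>n<N. t n q * cis (- (2 * pi * of_int m * q))) \<le> suminf M" .
      qed
      show "\<forall>q\<in>{0..1}. (\<lambda>N. \<Sum>n<N. t n q * cis (- (2 * pi * of_int m * q))) \<longlonglongrightarrow>
          (\<Sum>n. t n q) * cis (- (2 * pi * of_int m * q))"
        using tendsto_uniform_limitI[OF ul] by (auto intro!: tendsto_intros simp flip: sum_distrib_right)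
    qed (use \<open>y sums c m\<close> in \<open>simp_all add: sums_def integrable_on_const\<close>)
    from has_integral_diff[OF coeff[of m] this]
    show "((\<lambda>q. (g q - (\<Sum>n. t n q)) * cis (- (2 * pi * of_int m * q))) has_integral 0) {0..1}"
      by (simp add: left_diff_distrib)
  qed (use g cont g01 t01 q in \<open>auto intro!: continuous_intros\<close>)
  then show ?thesis by (simp add: t_def)
qed

section \<open>The Euler--Maclaurin continuation and Hurwitz's series\<close>

text \<open>The value \<epsilon> = 0 is included so that one estimate, uniform in \<epsilon>, serves
  both the Euler-Maclaurin remainder and the Abel regularization.\<close>

definition damped_powr :: "complex \<Rightarrow> real \<Rightarrow> real \<Rightarrow> complex" where
  "damped_powr s \<epsilon> x = of_real x powr (- s) * exp (- (of_real \<epsilon> * of_real x))"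

text \<open>\<open>F\<close> stands for an antiderivative of \<open>f\<close>; passing it as an
  argument admits a closed form as well as an integral from 0.\<close>

definition trapezoid_defect :: "(real \<Rightarrow> complex) \<Rightarrow> (real \<Rightarrow> complex) \<Rightarrow> real \<Rightarrow> complex" where
  "trapezoid_defect f F x = (f x + f (x + 1)) / 2 - (F (x + 1) - F x)"

lemma mult_exp_minus_le:
  fixes y :: real
  assumes "y \<ge> 0"
  shows "y * exp (- y) \<le> 1" "y\<^sup>2 * exp (- y) \<le> 2"
proof -
  have "y \<le> exp y" using exp_ge_add_one_self[of y] by linarith
  then show "y * exp (- y) \<le> 1" by (simp add: exp_minus field_simps)
  have "y\<^sup>2 \<le> 2 * exp y" using exp_lower_Taylor_quadratic[OF assms] assms by linarith
  then show "y\<^sup>2 * exp (- y) \<le> 2" by (simp add: exp_minus field_simps)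
qed

text \<open>With y = \<epsilon> t the second derivative is t^(-s-2) e^(-y) times s (s + 1) + 2 s y +
  y^2 up to signs absorbed by the norm, whose factors y e^(-y) \<le> 1 and y^2 e^(-y) \<le> 2 remove
  \<epsilon> from the bound. The condition on Re s makes t^(-Re s - 2) decreasing, so its value at x
  dominates on [x, x + 1].\<close>

lemma trapezoid_defect_damped_powr_le:
  assumes x: "x \<ge> 1" and \<epsilon>: "\<epsilon> \<ge> 0" and s: "Re s > -2"
    and F: "\<And>t. t \<in> {x..x+1} \<Longrightarrow> (F has_vector_derivative damped_powr s \<epsilon> t) (at t)"
  shows "norm (trapezoid_defect (damped_powr s \<epsilon>) F x)
           \<le> (norm s * norm (s + 1) + 2 * norm s + 2) * x powr (- Re s - 2)"
proof -
  define f' where "f' t = (- s * of_real t powr (- s - 1) - of_real \<epsilon> * of_real t powr (- s)) * exp (- (of_real \<epsilon> * of_real t))" for t :: real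
  define f'' where "f'' t = (s * (s + 1) * of_real t powr (- s - 2) + 2 * s * of_real \<epsilon> * of_real t powr (- s - 1)
     + (of_real \<epsilon>)\<^sup>2 * of_real t powr (- s)) * exp (- (of_real \<epsilon> * of_real t))" for t :: real
  have powr_deriv: "((\<lambda>z. z powr w) has_field_derivative w * of_real t powr (w - 1)) (at (of_real t))"
    if "t > 0" for w :: complex and t :: real
    using that by (intro has_field_derivative_powr) simp
  have exp_deriv: "((\<lambda>z. exp (- (of_real \<epsilon> * z))) has_field_derivative (- of_real \<epsilon>) * exp (- (of_real \<epsilon> * of_real t))) (at (of_real t))"
    for t :: real
    by (auto intro!: derivative_eq_intros)
  have d1: "(damped_powr s \<epsilon> has_vector_derivative f' t) (at t)" if "t > 0" for t
  proof -
    have "((\<lambda>z. z powr (- s) * exp (- (of_real \<epsilon> * z))) has_field_derivative f' t) (at (of_real t))"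
      by (rule DERIV_cong[OF DERIV_mult[OF powr_deriv[OF that] exp_deriv]]) (simp add: f'_def algebra_simps)
    from has_vector_derivative_real_field[OF this] show ?thesis by (simp add: damped_powr_def[abs_def])
  qed
  have d2: "(f' has_vector_derivative f'' t) (at t)" if "t > 0" for t
  proof -
    have "((\<lambda>z. (- s * z powr (- s - 1) - of_real \<epsilon> * z powr (- s)) * exp (- (of_real \<epsilon> * z))) has_field_derivative f'' t) (at (of_real t))"
      by (rule DERIV_cong[OF DERIV_mult[OF DERIV_diff[OF DERIV_cmult[OF powr_deriv[OF that]] DERIV_cmult[OF powr_deriv[OF that]]] exp_deriv]])
         (simp add: f''_def algebra_simps power2_eq_square)
    from has_vector_derivative_real_field[OF this] show ?thesis by (simp add: f'_def[abs_def])
  qed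
  have bound: "norm (f'' t) \<le> (norm s * norm (s + 1) + 2 * norm s + 2) * x powr (- Re s - 2)" if t: "t \<in> {x..x+1}" for t
  proof -
    have t0: "t > 0" using t x by auto
    define y where "y = \<epsilon> * t"
    have y: "y \<ge> 0" using \<epsilon> t0 by (simp add: y_def)
    have e: "- s - 2 + 1 = - s - 1" "- s - 2 + 2 = - s" by simp_all
    have p1: "complex_of_real t powr (- s - 1) = of_real t powr (- s - 2) * of_real t"
      using powr_add[of "complex_of_real t" "- s - 2" 1] t0 unfolding e by simp
    have p2: "complex_of_real t powr (- s) = of_real t powr (- s - 2) * (of_real t)\<^sup>2"
      using powr_add[of "complex_of_real t" "- s - 2" 2] t0 unfolding e by simp
    have "f'' t = of_real t powr (- s - 2) * (s * (s + 1) * of_real (exp (- y)) + 2 * s * of_real (y * exp (- y)) + of_real (y\<^sup>2 * exp (- y)))"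
      unfolding f''_def p1 p2 y_def by (simp add: algebra_simps power2_eq_square flip: exp_of_real)
    also have "norm \<dots> = t powr (- Re s - 2) * norm (s * (s + 1) * of_real (exp (- y)) + 2 * s * of_real (y * exp (- y)) + of_real (y\<^sup>2 * exp (- y)))"
      using t0 by (simp add: norm_mult norm_powr_real_powr)
    also have "\<dots> \<le> x powr (- Re s - 2) * (norm s * norm (s + 1) + 2 * norm s + 2)"
    proof (rule mult_mono)
      show "t powr (- Re s - 2) \<le> x powr (- Re s - 2)" using t x s by (intro powr_mono2') auto
      have "norm (s * (s + 1) * of_real (exp (- y)) + 2 * s * of_real (y * exp (- y)) + of_real (y\<^sup>2 * exp (- y)))
          \<le> norm s * norm (s + 1) * exp (- y) + 2 * norm s * (y * exp (- y)) + y\<^sup>2 * exp (- y)"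
        using y by (intro order_trans[OF norm_triangle_ineq] add_mono) (simp_all add: norm_mult norm_power del: of_real_mult)
      also have "\<dots> \<le> norm s * norm (s + 1) * 1 + 2 * norm s * 1 + 2"
        using mult_exp_minus_le[OF y] y by (intro add_mono mult_left_mono) auto
      finally show "norm (s * (s + 1) * of_real (exp (- y)) + 2 * s * of_real (y * exp (- y)) + of_real (y\<^sup>2 * exp (- y)))
          \<le> norm s * norm (s + 1) + 2 * norm s + 2" by simp
    qed auto
    finally show ?thesis by (simp add: mult.commute)
  qed
  have "norm ((1/2) *\<^sub>R (damped_powr s \<epsilon> x + damped_powr s \<epsilon> (x + 1)) - (F (x + 1) - F x))
     \<le> (norm s * norm (s + 1) + 2 * norm s + 2) * x powr (- Re s - 2)"
    using x by (intro trapezoid_error[of x F _ f' f''] F d1 d2 bound) auto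
  then show ?thesis by (simp add: trapezoid_defect_def scaleR_conv_of_real)
qed

lemma summable_Suc_powr: "e < -1 \<Longrightarrow> summable (\<lambda>n. real (Suc n) powr e)"
  using summable_Suc_iff[of "\<lambda>n. real n powr e"] summable_real_powr_iff[of e] by simp

definition em_term :: "complex \<Rightarrow> real \<Rightarrow> complex" where
  "em_term s = trapezoid_defect (\<lambda>x. of_real x powr (- s)) (\<lambda>x. of_real x powr (1 - s) / (1 - s))"

text \<open>Euler-Maclaurin for the terms with n \<ge> 1 only. All sample points are then at least
  1, so the remainder is controlled uniformly in q \<ge> 0.\<close>

definition hurwitz_em :: "complex \<Rightarrow> real \<Rightarrow> complex" where
  "hurwitz_em s q = of_real q powr (- s) + of_real (q + 1) powr (- s) / 2 + of_real (q + 1) powr (1 - s) / (s - 1)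
     + (\<Sum>n. em_term s (q + 1 + real n))"

lemma has_vector_derivative_powr_complex_exponent:
  assumes "t > 0" "s \<noteq> 1"
  shows "((\<lambda>x. of_real x powr (1 - s) / (1 - s)) has_vector_derivative damped_powr s 0 t) (at t)"
proof -
  have "((\<lambda>z. z powr (1 - s) / (1 - s)) has_field_derivative ((1 - s) * of_real t powr (1 - s - 1)) / (1 - s)) (at (of_real t))"
    using assms by (intro DERIV_cdivide has_field_derivative_powr) auto
  from has_vector_derivative_real_field[OF this] show ?thesis
    using assms by (simp add: damped_powr_def)
qed

text \<open>The parameters \<sigma> and R make the majorant uniform over a set of s, as the M-test
  on closed discs demands.\<close>

lemma em_term_le:
  assumes q: "q \<ge> 0" and s: "Re s \<ge> \<sigma>" "\<sigma> > -1" "s \<noteq> 1" and R: "norm s \<le> R"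
  shows "norm (em_term s (q + 1 + real n)) \<le> (R * (R + 1) + 2 * R + 2) * real (Suc n) powr (- \<sigma> - 2)"
proof -
  have x: "q + 1 + real n \<ge> 1" using q by simp
  have R0: "R \<ge> 0" using R norm_ge_zero order_trans by blast
  have "norm (s + 1) \<le> R + 1" using norm_triangle_ineq[of s 1] R by simp
  have "em_term s = trapezoid_defect (damped_powr s 0) (\<lambda>x. of_real x powr (1 - s) / (1 - s))"
    by (simp add: em_term_def damped_powr_def[abs_def])
  then have "norm (em_term s (q + 1 + real n)) \<le> (norm s * norm (s + 1) + 2 * norm s + 2) * (q + 1 + real n) powr (- Re s - 2)"
    using trapezoid_defect_damped_powr_le[OF x order_refl, of s "\<lambda>x. of_real x powr (1 - s) / (1 - s)"]
      has_vector_derivative_powr_complex_exponent[OF _ s(3)] x s by auto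
  also have "\<dots> \<le> (R * (R + 1) + 2 * R + 2) * real (Suc n) powr (- \<sigma> - 2)"
  proof (rule mult_mono)
    show "norm s * norm (s + 1) + 2 * norm s + 2 \<le> R * (R + 1) + 2 * R + 2"
      using R \<open>norm (s + 1) \<le> R + 1\<close> R0 by (intro add_mono mult_mono) auto
    have "(q + 1 + real n) powr (- Re s - 2) \<le> real (Suc n) powr (- Re s - 2)"
      using q s by (intro powr_mono2') auto
    also have "\<dots> \<le> real (Suc n) powr (- \<sigma> - 2)" using s by (intro powr_mono) auto
    finally show "(q + 1 + real n) powr (- Re s - 2) \<le> real (Suc n) powr (- \<sigma> - 2)" .
  qed (use R0 in auto)
  finally show ?thesis .
qed

lemma summable_em_term:
  assumes "q \<ge> 0" "Re s > -1" "s \<noteq> 1"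
  shows "summable (\<lambda>n. em_term s (q + 1 + real n))"
  by (rule summable_comparison_test'[OF summable_mult[OF summable_Suc_powr] em_term_le[OF assms(1) order_refl assms(2,3) order_refl]])
     (use assms in auto)

lemma cball_Re_bounds:
  assumes "s \<in> cball s0 d"
  shows "Re s \<ge> Re s0 - d" "Re s \<le> Re s0 + d" "norm s \<le> norm s0 + d"
  using assms abs_Re_le_cmod[of "s0 - s"] norm_triangle_ineq2[of s s0]
  by (auto simp: dist_norm norm_minus_commute)

lemma holomorphic_hurwitz_em:
  assumes q: "q > 0"
  shows "(\<lambda>s. hurwitz_em s q) holomorphic_on {s. Re s > -1} - {1}"
proof -
  let ?S = "{s. Re s > -1} - {1 :: complex}"
  have S: "open ?S" by (intro open_Diff open_halfspace_Re_gt) auto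
  have term_hol: "(\<lambda>s. em_term s x) holomorphic_on ?S" if "x > 0" for x
    unfolding em_term_def trapezoid_defect_def using that
    by (intro holomorphic_intros) (auto simp flip: of_real_add)
  have "(\<lambda>s. \<Sum>n. em_term s (q + 1 + real n)) holomorphic_on ?S"
  proof (rule holomorphic_uniform_sequence[OF S])
    show "(\<lambda>s. \<Sum>n<N. em_term s (q + 1 + real n)) holomorphic_on ?S" for N
      using q by (intro holomorphic_on_sum term_hol) auto
    fix s0 assume "s0 \<in> ?S"
    then obtain d where d: "d > 0" "cball s0 d \<subseteq> ?S" using S open_contains_cball by blast
    \<comment> \<open>The leftmost point of the disc still lies in the domain, which puts the
      exponent of the majorant below -1.\<close>
    have "s0 - of_real d \<in> cball s0 d" using d(1) by (simp add: dist_norm)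
    then have "s0 - of_real d \<in> ?S" using d(2) by blast
    then have "Re s0 - d > -1" by simp
    have "uniform_limit (cball s0 d) (\<lambda>N s. \<Sum>n<N. em_term s (q + 1 + real n)) (\<lambda>s. \<Sum>n. em_term s (q + 1 + real n)) sequentially"
    proof (rule Weierstrass_m_test)
      fix n s assume s: "s \<in> cball s0 d"
      then show "norm (em_term s (q + 1 + real n)) \<le> ((norm s0 + d) * ((norm s0 + d) + 1) + 2 * (norm s0 + d) + 2) * real (Suc n) powr (- (Re s0 - d) - 2)"
        using q cball_Re_bounds[OF s] \<open>Re s0 - d > -1\<close> d(2) by (intro em_term_le) auto
    next
      show "summable (\<lambda>n. ((norm s0 + d) * ((norm s0 + d) + 1) + 2 * (norm s0 + d) + 2) * real (Suc n) powr (- (Re s0 - d) - 2))"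
        using \<open>Re s0 - d > -1\<close> by (intro summable_mult summable_Suc_powr) auto
    qed
    then show "\<exists>d>0. cball s0 d \<subseteq> ?S \<and> uniform_limit (cball s0 d) (\<lambda>N s. \<Sum>n<N. em_term s (q + 1 + real n)) (\<lambda>s. \<Sum>n. em_term s (q + 1 + real n)) sequentially"
      using d by blast
  qed
  then show ?thesis unfolding hurwitz_em_def using q
    by (intro holomorphic_intros) (auto simp flip: of_real_add)
qed

lemma sum_trapezoid_defect:
  "(\<Sum>n<N. trapezoid_defect f F (x + real n)) =
     (\<Sum>n<N. f (x + real n)) - f x / 2 + f (x + real N) / 2 - F (x + real N) + F x"
proof (induction N)
  case (Suc N)
  have "x + real N + 1 = x + real (Suc N)" by simp
  then show ?case
    unfolding sum.lessThan_Suc Suc.IH by (simp add: trapezoid_defect_def field_simps)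
qed simp

lemma tendsto_of_real_powr_neg:
  assumes "Re w < 0"
  shows "(\<lambda>n. complex_of_real (x + real n) powr w) \<longlonglongrightarrow> 0"
proof (rule Lim_null_comparison)
  have "filterlim (\<lambda>n. x + real n) at_top sequentially"
    by (intro filterlim_tendsto_add_at_top[OF tendsto_const] filterlim_real_sequentially)
  then show "(\<lambda>n. (x + real n) powr Re w) \<longlonglongrightarrow> 0"
    using assms by (intro tendsto_neg_powr)
  have "eventually (\<lambda>n. real n \<ge> - x) sequentially"
    using filterlim_real_sequentially unfolding filterlim_at_top by blast
  then show "eventually (\<lambda>n. norm (complex_of_real (x + real n) powr w) \<le> (x + real n) powr Re w) sequentially"
  proof eventually_elim
    case (elim n)
    then have "Re (complex_of_real (x + real n)) \<ge> 0" by simp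
    from norm_powr_real_powr[OF Reals_of_real this] show ?case
      unfolding Re_complex_of_real by (intro eq_refl)
  qed
qed

text \<open>The trapezoid defects telescope to a partial sum of the series plus boundary terms, and
  for Re s > 1 the boundary terms at the far end tend to 0.\<close>

lemma hurwitz_em_sums:
  assumes q: "q > 0" and s: "Re s > 1"
  shows "(\<lambda>n. (of_nat n + complex_of_real q) powr (- s)) sums hurwitz_em s q"
proof -
  let ?F = "\<lambda>x. complex_of_real x powr (1 - s) / (1 - s)"
  have s1: "s \<noteq> 1" using s by auto
  have "(\<lambda>n. em_term s (q + 1 + real n)) sums (\<Sum>n. em_term s (q + 1 + real n))"
    using q s s1 by (intro summable_sums summable_em_term) auto
  then have "(\<lambda>N. \<Sum>n<N. em_term s (q + 1 + real n)) \<longlonglongrightarrow> (\<Sum>n. em_term s (q + 1 + real n))"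
    by (simp add: sums_def)
  moreover have "(\<lambda>N. complex_of_real (q + 1 + real N) powr (- s)) \<longlonglongrightarrow> 0"
    "(\<lambda>N. complex_of_real (q + 1 + real N) powr (1 - s)) \<longlonglongrightarrow> 0"
    by (rule tendsto_of_real_powr_neg, use s in simp)+
  ultimately have "(\<lambda>N. (\<Sum>n<N. em_term s (q + 1 + real n)) + complex_of_real (q + 1) powr (- s) / 2
        - complex_of_real (q + 1 + real N) powr (- s) / 2 + complex_of_real (q + 1 + real N) powr (1 - s) / (1 - s) - ?F (q + 1))
      \<longlonglongrightarrow> (\<Sum>n. em_term s (q + 1 + real n)) + complex_of_real (q + 1) powr (- s) / 2 - 0 / 2 + 0 / (1 - s) - ?F (q + 1)"
    using s1 by (intro tendsto_intros) auto
  moreover have "(\<Sum>n<N. em_term s (q + 1 + real n)) + complex_of_real (q + 1) powr (- s) / 2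
        - complex_of_real (q + 1 + real N) powr (- s) / 2 + complex_of_real (q + 1 + real N) powr (1 - s) / (1 - s) - ?F (q + 1)
      = (\<Sum>n<N. (of_nat (Suc n) + complex_of_real q) powr (- s))" for N
    unfolding em_term_def sum_trapezoid_defect by (simp add: add_ac)
  ultimately have "(\<lambda>n. (of_nat (Suc n) + complex_of_real q) powr (- s)) sums
      ((\<Sum>n. em_term s (q + 1 + real n)) + complex_of_real (q + 1) powr (- s) / 2 - 0 / 2 + 0 / (1 - s) - ?F (q + 1))"
    by (simp add: sums_def)
  then have "(\<lambda>n. (of_nat n + complex_of_real q) powr (- s)) sums
      ((\<Sum>n. em_term s (q + 1 + real n)) + complex_of_real (q + 1) powr (- s) / 2 - 0 / 2 + 0 / (1 - s) - ?F (q + 1) + (of_nat 0 + complex_of_real q) powr (- s))"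
    by (subst (asm) sums_Suc_iff) simp
  moreover have "(\<Sum>n. em_term s (q + 1 + real n)) + complex_of_real (q + 1) powr (- s) / 2 - 0 / 2 + 0 / (1 - s) - ?F (q + 1) + (of_nat 0 + complex_of_real q) powr (- s)
     = hurwitz_em s q"
  proof -
    have "- ?F (q + 1) = complex_of_real (q + 1) powr (1 - s) / (s - 1)"
      by (simp add: minus_divide_right)
    then show ?thesis unfolding hurwitz_em_def by simp
  qed
  ultimately show ?thesis by simp
qed

section \<open>Hurwitz's trigonometric series as a holomorphic function of s\<close>

definition dirichlet_sum :: "(nat \<Rightarrow> real) \<Rightarrow> complex \<Rightarrow> complex" where
  "dirichlet_sum c s = (\<Sum>n. of_real (c (Suc n)) * of_nat (Suc n) powr (s - 1))"

lemma holomorphic_dirichlet_sum: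
  assumes c: "\<And>n. \<bar>c n\<bar> \<le> 1"
  shows "dirichlet_sum c holomorphic_on {s. Re s < 0}"
proof -
  let ?S = "{s. Re s < 0}"
  let ?t = "\<lambda>n s. complex_of_real (c (Suc n)) * of_nat (Suc n) powr (s - 1)"
  have S: "open ?S" by (rule open_halfspace_Re_lt)
  have "(\<lambda>s. \<Sum>n. ?t n s) holomorphic_on ?S"
  proof (rule holomorphic_uniform_sequence[OF S])
    show "(\<lambda>s. \<Sum>n<N. ?t n s) holomorphic_on ?S" for N
      by (intro holomorphic_intros) (auto simp del: of_nat_Suc)
    fix s0 assume "s0 \<in> ?S"
    then obtain d where d: "d > 0" "cball s0 d \<subseteq> ?S" using S open_contains_cball by blast
    have "s0 + of_real d \<in> cball s0 d" using d(1) by (simp add: dist_norm)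
    then have "s0 + of_real d \<in> ?S" using d(2) by blast
    then have d0: "Re s0 + d < 0" by simp
    have "uniform_limit (cball s0 d) (\<lambda>N s. \<Sum>n<N. ?t n s) (\<lambda>s. \<Sum>n. ?t n s) sequentially"
    proof (rule Weierstrass_m_test)
      fix n s assume s: "s \<in> cball s0 d"
      have "norm (?t n s) = \<bar>c (Suc n)\<bar> * real (Suc n) powr (Re s - 1)"
        unfolding norm_mult by (subst norm_powr_real_powr) (auto simp del: of_nat_Suc)
      also have "\<dots> \<le> 1 * real (Suc n) powr (Re s0 + d - 1)"
        using cball_Re_bounds[OF s] c by (intro mult_mono powr_mono) auto
      finally show "norm (?t n s) \<le> real (Suc n) powr (Re s0 + d - 1)" by simp
    next
      show "summable (\<lambda>n. real (Suc n) powr (Re s0 + d - 1))"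
        using d0 by (intro summable_Suc_powr) auto
    qed
    then show "\<exists>d>0. cball s0 d \<subseteq> ?S \<and> uniform_limit (cball s0 d) (\<lambda>N s. \<Sum>n<N. ?t n s) (\<lambda>s. \<Sum>n. ?t n s) sequentially"
      using d by blast
  qed
  then show ?thesis by (simp add: dirichlet_sum_def[abs_def])
qed

lemma dirichlet_sum_sums:
  assumes c: "\<And>n. \<bar>c n\<bar> \<le> 1" and s: "Re s < 0"
  shows "(\<lambda>n. complex_of_real (c (Suc n)) * of_nat (Suc n) powr (s - 1)) sums dirichlet_sum c s"
  unfolding dirichlet_sum_def
proof (rule summable_sums, rule summable_comparison_test')
  show "summable (\<lambda>n. real (Suc n) powr (Re s - 1))" using s by (intro summable_Suc_powr) auto
  fix n :: nat
  have "norm (complex_of_real (c (Suc n)) * of_nat (Suc n) powr (s - 1)) = \<bar>c (Suc n)\<bar> * real (Suc n) powr (Re s - 1)"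
    unfolding norm_mult by (subst norm_powr_real_powr) (auto simp del: of_nat_Suc)
  also have "\<dots> \<le> 1 * real (Suc n) powr (Re s - 1)" using c by (intro mult_right_mono) auto
  finally show "norm (complex_of_real (c (Suc n)) * of_nat (Suc n) powr (s - 1)) \<le> real (Suc n) powr (Re s - 1)" by simp
qed

definition hurwitz_fourier :: "complex \<Rightarrow> real \<Rightarrow> complex" where
  "hurwitz_fourier s q = 2 * Gamma (1 - s) * of_real (2 * pi) powr (s - 1) *
     (sin (of_real pi * s / 2) * dirichlet_sum (\<lambda>n. cos (2 * pi * n * q)) s +
      cos (of_real pi * s / 2) * dirichlet_sum (\<lambda>n. sin (2 * pi * n * q)) s)"

lemma holomorphic_hurwitz_fourier: "(\<lambda>s. hurwitz_fourier s q) holomorphic_on {s. Re s < 0}"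
proof -
  have "1 - s \<notin> \<int>\<^sub>\<le>\<^sub>0" if "Re s < 0" for s :: complex
    using that nonpos_Ints_nonpos[of "Re (1 - s)"] by (auto elim!: nonpos_Ints_cases simp: complex_eq_iff)
  then show ?thesis
    unfolding hurwitz_fourier_def
    by (intro holomorphic_intros holomorphic_dirichlet_sum holomorphic_on_compose_gen[of "\<lambda>s. 1 - s" _ Gamma "- \<int>\<^sub>\<le>\<^sub>0", unfolded o_def] holomorphic_Gamma) auto
qed

section \<open>Fourier coefficients by Abel regularization\<close>

lemma integral_Icc_tendsto_has_integral:
  fixes f :: "real \<Rightarrow> 'a::euclidean_space" and g :: "real \<Rightarrow> real"
  assumes f: "(f has_integral I) {0..}" and g: "g integrable_on {0..}"
    and le: "\<And>x. x \<ge> 0 \<Longrightarrow> norm (f x) \<le> g x"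
    and f_int: "\<And>X. f integrable_on {0..X}"
    and X: "filterlim X at_top sequentially"
  shows "(\<lambda>n. integral {0..X n} f) \<longlonglongrightarrow> I"
proof -
  let ?f = "\<lambda>n x. if x \<in> {0..X n} then f x else 0"
  have sub: "{0..} \<inter> {0..X n} = {0..X n}" "{0..X n} \<inter> {0..} = {0..X n}" for n by auto
  have "(\<lambda>n. integral {0..} (?f n)) \<longlonglongrightarrow> integral {0..} f"
  proof (rule dominated_convergence(2)[OF _ g])
    show "?f n integrable_on {0..}" for n
      unfolding integrable_restrict_Int sub by (rule f_int)
    show "norm (?f n x) \<le> g x" if "x \<in> {0..}" for n x
      using le[of x] that order_trans[OF norm_ge_zero le[of x]] by auto
    show "(\<lambda>n. ?f n x) \<longlonglongrightarrow> f x" if "x \<in> {0..}" for x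
    proof (rule tendsto_eventually)
      have "eventually (\<lambda>n. x \<le> X n) sequentially" using X unfolding filterlim_at_top by blast
      then show "eventually (\<lambda>n. ?f n x = f x) sequentially"
        by eventually_elim (use that in auto)
    qed
  qed
  then show ?thesis
    unfolding integral_restrict_Int sub using f by (simp add: integral_unique)
qed

text \<open>The characters exp (-2 pi i m x) have period 1. Applied to a damped power times such a
  character, this turns an integral over one period into one over [0, N].\<close>

lemma has_integral_sum_translates:
  fixes f :: "real \<Rightarrow> 'a::euclidean_space"
  assumes "\<And>X. f integrable_on {0..X}"
  shows "((\<lambda>q. \<Sum>n<N. f (q + real n)) has_integral integral {0..real N} f) {0..1}"
proof (induction N)
  case (Suc N)
  have "f integrable_on {real N..real N + 1}"
    using assms[of "real N + 1"] by (rule integrable_on_subinterval) auto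
  then have "(f has_integral integral {real N..real N + 1} f) {0 + real N..1 + real N}"
    by (simp add: add.commute integrable_integral)
  then have "((f \<circ> (+) (real N)) has_integral integral {real N..real N + 1} f) {0..1}"
    by (subst has_integral_shift_Icc_real)
  then have "((\<lambda>q. f (q + real N)) has_integral integral {real N..real N + 1} f) {0..1}"
    by (simp add: o_def add.commute)
  from has_integral_add[OF Suc.IH this]
  have "((\<lambda>q. \<Sum>n<Suc N. f (q + real n)) has_integral
     (integral {0..real N} f + integral {real N..real N + 1} f)) {0..1}" by simp
  also have "integral {0..real N} f + integral {real N..real N + 1} f = integral {0..real N + 1} f"
    using assms by (intro Henstock_Kurzweil_Integration.integral_combine) auto
  finally show ?case by (simp add: add.commute)
qed simp

text \<open>Here p = -s. Positivity of p makes x^p continuous at 0 with value 0, which gives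
  continuity and periodicity on the closed period; p < 1 keeps the remainder exponent p - 2 below
  -1.\<close>

context
  fixes p :: real
  assumes p: "0 < p" "p < 1"
begin

abbreviation damped :: "real \<Rightarrow> real \<Rightarrow> complex" where "damped \<equiv> damped_powr (- of_real p)"

lemma damped_eq: "x \<ge> 0 \<Longrightarrow> damped \<epsilon> x = of_real (x powr p * exp (- (\<epsilon> * x)))"
  by (simp add: damped_powr_def powr_of_real flip: exp_of_real)

lemma norm_damped: "x \<ge> 0 \<Longrightarrow> norm (damped \<epsilon> x) = x powr p * exp (- (\<epsilon> * x))"
  by (simp add: damped_eq norm_mult)

lemma norm_damped_le: "x \<ge> 0 \<Longrightarrow> \<epsilon> \<ge> 0 \<Longrightarrow> norm (damped \<epsilon> x) \<le> x powr p"
  by (simp add: norm_damped mult_left_le)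

lemma continuous_on_damped: "continuous_on {0..} (damped \<epsilon>)"
proof -
  have "continuous_on {0..} (\<lambda>x. complex_of_real (x powr p * exp (- (\<epsilon> * x))))"
    using p by (intro continuous_intros continuous_on_powr') auto
  then show ?thesis by (rule continuous_on_eq) (simp add: damped_eq)
qed

lemma continuous_on_damped_compose:
  "continuous_on A f \<Longrightarrow> (\<And>x. x \<in> A \<Longrightarrow> f x \<ge> 0) \<Longrightarrow> continuous_on A (\<lambda>x. damped \<epsilon> (f x))"
  by (rule continuous_on_compose2[OF continuous_on_damped]) auto

lemma damped_integrable: "damped \<epsilon> integrable_on {0..X}"
  by (intro integrable_continuous_interval continuous_on_subset[OF continuous_on_damped]) auto

text \<open>Integration starts at 0 so that \<epsilon> = 0 reproduces x^(p+1) / (p+1), the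
  antiderivative in \<open>em_term\<close>, while for \<epsilon> > 0 the limit at infinity is the
  full Gamma integral.\<close>

definition damped_integral :: "real \<Rightarrow> real \<Rightarrow> complex" where "damped_integral \<epsilon> x = integral {0..x} (damped \<epsilon>)"

lemma damped_integral_deriv:
  assumes "t > 0"
  shows "(damped_integral \<epsilon> has_vector_derivative damped \<epsilon> t) (at t)"
proof -
  have "((\<lambda>u. integral {0..u} (damped \<epsilon>)) has_vector_derivative damped \<epsilon> t) (at t within {0..t+1})"
    using assms by (intro integral_has_vector_derivative continuous_on_subset[OF continuous_on_damped]) auto
  moreover have "at t within {0..t+1} = at t" using assms by (intro at_within_interior) auto
  ultimately show ?thesis by (simp add: damped_integral_def[abs_def])
qed

lemma continuous_on_damped_integral_compose:
  assumes "continuous_on A f" "\<And>x. x \<in> A \<Longrightarrow> f x > 0"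
  shows "continuous_on A (\<lambda>x. damped_integral \<epsilon> (f x))"
proof (rule continuous_on_compose2[OF _ assms(1)])
  show "continuous_on {0<..} (damped_integral \<epsilon>)"
    by (intro continuous_at_imp_continuous_on ballI has_vector_derivative_continuous[OF damped_integral_deriv]) auto
qed (use assms in auto)

lemma damped_integral_0: "x \<ge> 0 \<Longrightarrow> damped_integral 0 x = of_real (x powr (p + 1) / (p + 1))"
proof -
  assume "x \<ge> 0"
  then have "((\<lambda>t. complex_of_real (t powr p)) has_integral of_real (x powr (p + 1) / (p + 1))) {0..x}"
    using p by (intro has_integral_of_real has_integral_powr_from_0) auto
  then have "(damped 0 has_integral of_real (x powr (p + 1) / (p + 1))) {0..x}"
    by (rule has_integral_eq[rotated]) (simp add: damped_eq)
  then show ?thesis unfolding damped_integral_def by (rule integral_unique)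
qed

lemma damped_has_integral:
  assumes "\<epsilon> > 0"
  shows "((\<lambda>x. damped \<epsilon> x * cis (- (2 * pi * y * x))) has_integral
     (of_real (Gamma (p + 1)) * (of_real \<epsilon> + 2 * of_real pi * \<i> * of_real y) powr (- of_real (p + 1)))) {0..}"
proof -
  have "((\<lambda>x. complex_of_real (x powr (p + 1 - 1)) * exp (- ((of_real \<epsilon> + 2 * of_real pi * \<i> * of_real y) * of_real x))) has_integral
     (of_real (Gamma (p + 1)) * (of_real \<epsilon> + 2 * of_real pi * \<i> * of_real y) powr (- of_real (p + 1)))) {0..}"
    using p assms by (intro has_integral_Gamma_rate_complex) auto
  then show ?thesis
  proof (rule has_integral_eq[rotated])
    fix x :: real assume "x \<in> {0..}"
    then show "complex_of_real (x powr (p + 1 - 1)) * exp (- ((of_real \<epsilon> + 2 * of_real pi * \<i> * of_real y) * of_real x))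
       = damped \<epsilon> x * cis (- (2 * pi * y * x))"
      by (simp add: damped_eq cis_conv_exp mult.assoc flip: exp_of_real exp_add) (simp add: algebra_simps)
  qed
qed

lemma norm_damped_integrable:
  assumes "\<epsilon> > 0"
  shows "(\<lambda>x. x powr p * exp (- (\<epsilon> * x))) integrable_on {0..}"
  using has_integral_Gamma_rate_real[of "p + 1" \<epsilon>] p assms by auto

lemma damped_integral_tendsto:
  assumes \<epsilon>: "\<epsilon> > 0" and X: "filterlim X at_top sequentially"
  shows "(\<lambda>n. damped_integral \<epsilon> (X n)) \<longlonglongrightarrow> of_real (Gamma (p + 1)) * of_real \<epsilon> powr (- of_real (p + 1))"
  unfolding damped_integral_def
proof (rule integral_Icc_tendsto_has_integral[OF _ norm_damped_integrable[OF \<epsilon>] _ damped_integrable X])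
  show "(damped \<epsilon> has_integral of_real (Gamma (p + 1)) * of_real \<epsilon> powr (- of_real (p + 1))) {0..}"
    using damped_has_integral[OF \<epsilon>, of 0] by simp
qed (simp add: norm_damped)

lemma norm_damped_integral_le:
  assumes \<epsilon>: "\<epsilon> > 0"
  shows "norm (damped_integral \<epsilon> x) \<le> integral {0..} (\<lambda>x. x powr p * exp (- (\<epsilon> * x)))"
proof -
  have int: "(\<lambda>x. x powr p * exp (- (\<epsilon> * x))) integrable_on {0..x}"
    using norm_damped_integrable[OF \<epsilon>] by (rule integrable_on_subinterval) auto
  have "norm (damped_integral \<epsilon> x) \<le> integral {0..x} (\<lambda>x. x powr p * exp (- (\<epsilon> * x)))"
    unfolding damped_integral_def by (intro integral_norm_bound_integral damped_integrable int) (simp add: norm_damped)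
  also have "\<dots> \<le> integral {0..} (\<lambda>x. x powr p * exp (- (\<epsilon> * x)))"
    by (intro integral_subset_le int norm_damped_integrable[OF \<epsilon>]) auto
  finally show ?thesis .
qed

lemma norm_damped_bounded:
  assumes \<epsilon>: "\<epsilon> > 0" and x: "x \<ge> 0"
  shows "norm (damped \<epsilon> x) \<le> 1 + 1 / \<epsilon>"
proof -
  have "x powr p \<le> 1 + x"
  proof (cases "x \<le> 1")
    case True
    then have "x powr p \<le> 1" using x p by (intro powr_le1) auto
    then show ?thesis using x by simp
  next
    case False
    then have "x powr p \<le> x powr 1" using p by (intro powr_mono) auto
    then show ?thesis using False by simp
  qed
  then have "norm (damped \<epsilon> x) \<le> (1 + x) * exp (- (\<epsilon> * x))"
    unfolding norm_damped[OF x] by (intro mult_right_mono) auto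
  also have "\<dots> = exp (- (\<epsilon> * x)) + (\<epsilon> * x * exp (- (\<epsilon> * x))) / \<epsilon>"
    using \<epsilon> by (simp add: field_simps)
  also have "\<dots> \<le> 1 + 1 / \<epsilon>"
    using mult_exp_minus_le(1)[of "\<epsilon> * x"] \<epsilon> x by (intro add_mono divide_right_mono) auto
  finally show ?thesis .
qed

lemma damped_tendsto_at_top:
  assumes \<epsilon>: "\<epsilon> > 0"
  shows "(damped \<epsilon> \<longlongrightarrow> 0) at_top"
proof (rule Lim_null_comparison)
  have "filterlim (\<lambda>x. \<epsilon> / 2 * x) at_top at_top"
    using \<epsilon> by (intro filterlim_tendsto_pos_mult_at_top[OF tendsto_const _ filterlim_ident]) simp
  then have "((\<lambda>x. exp (- (\<epsilon> / 2 * x))) \<longlongrightarrow> 0) at_top"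
    by (intro filterlim_compose[OF exp_at_bot]) (simp add: filterlim_uminus_at_bot)
  from tendsto_mult_right_zero[OF this]
  show "((\<lambda>x. (1 + 1 / (\<epsilon> / 2)) * exp (- (\<epsilon> / 2 * x))) \<longlongrightarrow> 0) at_top" .
  show "eventually (\<lambda>x. norm (damped \<epsilon> x) \<le> (1 + 1 / (\<epsilon> / 2)) * exp (- (\<epsilon> / 2 * x))) at_top"
    using eventually_ge_at_top[of 0]
  proof eventually_elim
    case (elim x)
    \<comment> \<open>Half of the damping is spent on boundedness; the other half forces the
      decay.\<close>
    have "norm (damped \<epsilon> x) = norm (damped (\<epsilon> / 2) x) * exp (- (\<epsilon> / 2 * x))"
      using elim by (simp add: norm_damped mult.assoc flip: exp_add)
    also have "\<dots> \<le> (1 + 1 / (\<epsilon> / 2)) * exp (- (\<epsilon> / 2 * x))"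
      using norm_damped_bounded[of "\<epsilon> / 2" x] \<epsilon> elim by (intro mult_right_mono) auto
    finally show ?case .
  qed
qed

text \<open>For \<open>\<epsilon> > 0\<close>, \<open>regularized \<epsilon> q\<close> is \<open>\<Sum>n. damped \<epsilon> (n + q)\<close> minus the integral of \<open>damped \<epsilon>\<close> over the half-line,
  which blows up as \<open>\<epsilon>\<close> tends to 0. The trapezoid form also makes sense at \<open>\<epsilon> = 0\<close> and is
  continuous there.\<close>

definition damped_defect :: "real \<Rightarrow> real \<Rightarrow> complex" where
  "damped_defect \<epsilon> = trapezoid_defect (damped \<epsilon>) (damped_integral \<epsilon>)"

definition regularized_sum :: "nat \<Rightarrow> real \<Rightarrow> real \<Rightarrow> complex" where
  "regularized_sum N \<epsilon> q = damped \<epsilon> q + damped \<epsilon> (q + 1) / 2 - damped_integral \<epsilon> (q + 1) + (\<Sum>n<N. damped_defect \<epsilon> (q + 1 + real n))"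

definition regularized :: "real \<Rightarrow> real \<Rightarrow> complex" where
  "regularized \<epsilon> q = damped \<epsilon> q + damped \<epsilon> (q + 1) / 2 - damped_integral \<epsilon> (q + 1) + (\<Sum>n. damped_defect \<epsilon> (q + 1 + real n))"

text \<open>The bound of \<open>trapezoid_defect_damped_powr_le\<close> at s = -p, with the sample
  point replaced by its lower bound n + 1. It involves neither q nor \<epsilon>, so it dominates
  both the infinite sum and the limit \<epsilon> to 0.\<close>

definition defect_bound :: "nat \<Rightarrow> real" where
  "defect_bound n = (norm (- of_real p :: complex) * norm (- of_real p + 1 :: complex) + 2 * norm (- of_real p :: complex) + 2)
          * real (Suc n) powr (p - 2)"

lemma summable_defect_bound: "summable defect_bound"
  unfolding defect_bound_def using p by (intro summable_mult summable_Suc_powr) auto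

lemma defect_bound_nonneg: "defect_bound n \<ge> 0"
  unfolding defect_bound_def by auto

lemma damped_defect_le:
  assumes q: "q \<ge> 0" and \<epsilon>: "\<epsilon> \<ge> 0"
  shows "norm (damped_defect \<epsilon> (q + 1 + real n)) \<le> defect_bound n"
proof -
  have "norm (damped_defect \<epsilon> (q + 1 + real n)) \<le> (norm (- of_real p :: complex) * norm (- of_real p + 1 :: complex) + 2 * norm (- of_real p :: complex) + 2)
          * (q + 1 + real n) powr (- Re (- of_real p) - 2)"
    unfolding damped_defect_def using q p by (intro trapezoid_defect_damped_powr_le \<epsilon> damped_integral_deriv) auto
  also have "\<dots> \<le> defect_bound n"
    unfolding defect_bound_def using q p by (intro mult_left_mono) (auto intro!: powr_mono2')
  finally show ?thesis .
qed

lemma regularized_sum_tendsto: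
  assumes "q \<ge> 0" "\<epsilon> \<ge> 0"
  shows "(\<lambda>N. regularized_sum N \<epsilon> q) \<longlonglongrightarrow> regularized \<epsilon> q"
  unfolding regularized_sum_def regularized_def
  by (intro tendsto_intros summable_LIMSEQ summable_comparison_test'[OF summable_defect_bound damped_defect_le[OF assms]])

text \<open>The defining form behaves well as \<epsilon> tends to 0; this one exhibits plain
  translates, whose Fourier coefficients can be computed.\<close>

lemma regularized_sum_eq:
  "regularized_sum N \<epsilon> q = (\<Sum>n<Suc N. damped \<epsilon> (q + real n)) + damped \<epsilon> (q + 1 + real N) / 2 - damped_integral \<epsilon> (q + 1 + real N)"
  unfolding regularized_sum_def damped_defect_def sum_trapezoid_defect sum.lessThan_Suc_shift
  by (simp add: add_ac)

text \<open>On [0, 2] the damped power is at most 2^p \<le> 2, which accounts for 2 and for its half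
  1; integrating it over a length of at most 2 gives 4.\<close>

lemma regularized_sum_le:
  assumes q: "q \<in> {0..1}" and \<epsilon>: "\<epsilon> \<ge> 0"
  shows "norm (regularized_sum N \<epsilon> q) \<le> 2 + 1 + 4 + suminf defect_bound"
proof -
  have h2: "norm (damped \<epsilon> x) \<le> 2" if "x \<in> {0..2}" for x
  proof -
    have "norm (damped \<epsilon> x) \<le> x powr p" using that \<epsilon> by (intro norm_damped_le) auto
    also have "\<dots> \<le> 2 powr p" using that p by (intro powr_mono2) auto
    also have "\<dots> \<le> 2 powr 1" using p by (intro powr_mono) auto
    finally show ?thesis by simp
  qed
  have "norm (damped_integral \<epsilon> (q + 1)) \<le> 2 * (q + 1 - 0)"
    unfolding damped_integral_def using q h2
    by (intro integral_bound continuous_on_subset[OF continuous_on_damped]) auto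
  then have G4: "norm (damped_integral \<epsilon> (q + 1)) \<le> 4" using q by simp
  have "norm (\<Sum>n<N. damped_defect \<epsilon> (q + 1 + real n)) \<le> (\<Sum>n<N. defect_bound n)"
    using damped_defect_le q \<epsilon> by (intro sum_norm_le) auto
  also have "\<dots> \<le> suminf defect_bound" by (intro sum_le_suminf summable_defect_bound) (auto simp: defect_bound_nonneg)
  finally have damped_defect: "norm (\<Sum>n<N. damped_defect \<epsilon> (q + 1 + real n)) \<le> suminf defect_bound" .
  have "norm (damped \<epsilon> q) \<le> 2" "norm (damped \<epsilon> (q + 1) / 2) \<le> 1"
    using h2[of q] h2[of "q + 1"] q by (auto simp: norm_divide)
  then show ?thesis
    unfolding regularized_sum_def using G4 damped_defect by (intro norm_triangle_mono norm_diff_triangle_le[of _ 0 _ _ 4, simplified]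
      order_trans[OF norm_triangle_ineq4] add_mono)
qed

lemma continuous_on_regularized_sum: "continuous_on {0..1} (regularized_sum N \<epsilon>)"
  unfolding regularized_sum_eq[abs_def]
  by (intro continuous_intros continuous_on_damped_compose continuous_on_damped_integral_compose) auto

lemma regularized_integrable_and_limit:
  assumes "\<epsilon> \<ge> 0"
  shows "(\<lambda>q. regularized \<epsilon> q * cis (- (2 * pi * of_int m * q))) integrable_on {0..1}"
    and "(\<lambda>N. integral {0..1} (\<lambda>q. regularized_sum N \<epsilon> q * cis (- (2 * pi * of_int m * q))))
      \<longlonglongrightarrow> integral {0..1} (\<lambda>q. regularized \<epsilon> q * cis (- (2 * pi * of_int m * q)))"
proof -
  have 1: "(\<lambda>q. regularized_sum N \<epsilon> q * cis (- (2 * pi * of_int m * q))) integrable_on {0..1}" for N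
    by (intro integrable_continuous_interval continuous_intros continuous_on_regularized_sum)
  have 2: "(\<lambda>q. 2 + 1 + 4 + suminf defect_bound) integrable_on {0..1::real}" by (rule integrable_on_const) auto
  have 3: "norm (regularized_sum N \<epsilon> q * cis (- (2 * pi * of_int m * q))) \<le> 2 + 1 + 4 + suminf defect_bound" if "q \<in> {0..1}" for N q
    using regularized_sum_le[OF that assms] by (simp add: norm_mult)
  have 4: "(\<lambda>N. regularized_sum N \<epsilon> q * cis (- (2 * pi * of_int m * q))) \<longlonglongrightarrow> regularized \<epsilon> q * cis (- (2 * pi * of_int m * q))"
    if "q \<in> {0..1}" for q
    using that assms by (intro tendsto_mult tendsto_const regularized_sum_tendsto) auto
  show "(\<lambda>q. regularized \<epsilon> q * cis (- (2 * pi * of_int m * q))) integrable_on {0..1}"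
    by (rule dominated_convergence(1)[OF 1 2 3 4])
  show "(\<lambda>N. integral {0..1} (\<lambda>q. regularized_sum N \<epsilon> q * cis (- (2 * pi * of_int m * q))))
      \<longlonglongrightarrow> integral {0..1} (\<lambda>q. regularized \<epsilon> q * cis (- (2 * pi * of_int m * q)))"
    by (rule dominated_convergence(2)[OF 1 2 3 4])
qed

lemma cis_period: "cis (- (2 * pi * of_int m * (q + real n))) = cis (- (2 * pi * of_int m * q))"
proof -
  have "cis (- (2 * pi * of_int m * (q + real n))) = cis (- (2 * pi * of_int m * q)) * cis (2 * pi * of_int (- m * int n))"
    by (simp add: cis_mult algebra_simps)
  also have "cis (2 * pi * of_int (- m * int n)) = 1" by (rule cis_multiple_2pi) simp
  finally show ?thesis by simp
qed

text \<open>The N + 1 translates unfold to a Fourier integral over [0, N + 1], which tends to the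
  Gamma integral \<open>J\<close>. The remainder tends to minus the integral \<open>Ginf\<close>
  over the half-line. That is constant in q, so it contributes only for m = 0, where it cancels
  \<open>J\<close>.\<close>

lemma regularized_coefficient:
  assumes \<epsilon>: "\<epsilon> > 0"
  shows "integral {0..1} (\<lambda>q. regularized \<epsilon> q * cis (- (2 * pi * of_int m * q))) =
    (if m = 0 then 0 else
      of_real (Gamma (p + 1)) * (of_real \<epsilon> + 2 * of_real pi * \<i> * of_int m) powr (- of_real (p + 1)))"
proof -
  define e where "e q = cis (- (2 * pi * of_int m * q))" for q :: real
  define J where "J = of_real (Gamma (p + 1)) * (of_real \<epsilon> + 2 * of_real pi * \<i> * of_int m) powr (- of_real (p + 1))"
  define Ginf where "Ginf = of_real (Gamma (p + 1)) * complex_of_real \<epsilon> powr (- of_real (p + 1))"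
  \<comment> \<open>What remains of \<open>regularized_sum\<close> beside the N + 1
    translates.\<close>
  define r where "r N q = damped \<epsilon> (q + 1 + real N) / 2 - damped_integral \<epsilon> (q + 1 + real N)" for N q
  have e_cont: "continuous_on A e" for A unfolding e_def by (intro continuous_intros)
  have e_period: "e (q + real n) = e q" for q n unfolding e_def by (rule cis_period)
  have he_int: "(\<lambda>x. damped \<epsilon> x * e x) integrable_on {0..X}" for X
    by (intro integrable_continuous_interval continuous_on_mult e_cont continuous_on_subset[OF continuous_on_damped]) auto
  have lim_at_top: "filterlim (\<lambda>N. q + 1 + real N) at_top sequentially" for q
    by (intro filterlim_tendsto_add_at_top[OF tendsto_const] filterlim_real_sequentially)
  have "((\<lambda>x. damped \<epsilon> x * e x) has_integral J) {0..}"
    using damped_has_integral[OF \<epsilon>, of "of_int m"] by (simp add: e_def J_def)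
  then have main: "(\<lambda>N. integral {0..real (Suc N)} (\<lambda>x. damped \<epsilon> x * e x)) \<longlonglongrightarrow> J"
    using lim_at_top[of 0]
    by (intro integral_Icc_tendsto_has_integral[OF _ norm_damped_integrable[OF \<epsilon>] _ he_int])
       (auto simp: norm_mult norm_damped e_def)
  have r_cont: "continuous_on {0..1} (r N)" for N
    unfolding r_def by (intro continuous_intros continuous_on_damped_compose continuous_on_damped_integral_compose) auto
  have r_int: "(\<lambda>q. r N q * e q) integrable_on {0..1}" for N
    by (intro integrable_continuous_interval continuous_on_mult e_cont r_cont)
  have rest: "(\<lambda>N. integral {0..1} (\<lambda>q. r N q * e q)) \<longlonglongrightarrow> integral {0..1} (\<lambda>q. - Ginf * e q)"
  proof (rule dominated_convergence(2)[OF r_int])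
    show "(\<lambda>q. (1 + 1 / \<epsilon>) / 2 + integral {0..} (\<lambda>x. x powr p * exp (- (\<epsilon> * x)))) integrable_on {0..1::real}"
      by (rule integrable_on_const) auto
    fix q :: real assume q: "q \<in> {0..1}"
    show "norm (r N q * e q) \<le> (1 + 1 / \<epsilon>) / 2 + integral {0..} (\<lambda>x. x powr p * exp (- (\<epsilon> * x)))" for N
    proof -
      have "norm (r N q * e q) = norm (r N q)" by (simp add: norm_mult e_def)
      also have "\<dots> \<le> norm (damped \<epsilon> (q + 1 + real N) / 2) + norm (damped_integral \<epsilon> (q + 1 + real N))"
        unfolding r_def by (rule norm_triangle_ineq4)
      also have "\<dots> \<le> (1 + 1 / \<epsilon>) / 2 + integral {0..} (\<lambda>x. x powr p * exp (- (\<epsilon> * x)))"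
        using norm_damped_bounded[OF \<epsilon>, of "q + 1 + real N"] q
        by (intro add_mono norm_damped_integral_le[OF \<epsilon>]) (simp add: norm_divide)
      finally show ?thesis .
    qed
    have h0: "(\<lambda>N. damped \<epsilon> (q + 1 + real N)) \<longlonglongrightarrow> 0"
      using q by (intro filterlim_compose[OF damped_tendsto_at_top[OF \<epsilon>] lim_at_top])
    have "(\<lambda>N. r N q * e q) \<longlonglongrightarrow> (0 / 2 - Ginf) * e q"
      unfolding r_def Ginf_def by (intro tendsto_intros h0 damped_integral_tendsto[OF \<epsilon> lim_at_top]) auto
    then show "(\<lambda>N. r N q * e q) \<longlonglongrightarrow> - Ginf * e q" by simp
  qed
  have "integral {0..1} (\<lambda>q. regularized_sum N \<epsilon> q * e q) = integral {0..real (Suc N)} (\<lambda>x. damped \<epsilon> x * e x) + integral {0..1} (\<lambda>q. r N q * e q)" for N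
  proof (rule integral_unique)
    have "((\<lambda>q. (\<Sum>n<Suc N. damped \<epsilon> (q + real n) * e (q + real n)) + r N q * e q) has_integral
        integral {0..real (Suc N)} (\<lambda>x. damped \<epsilon> x * e x) + integral {0..1} (\<lambda>q. r N q * e q)) {0..1}"
      by (intro has_integral_add has_integral_sum_translates he_int integrable_integral r_int)
    also have "(\<lambda>q. (\<Sum>n<Suc N. damped \<epsilon> (q + real n) * e (q + real n)) + r N q * e q) = (\<lambda>q. regularized_sum N \<epsilon> q * e q)"
      unfolding regularized_sum_eq r_def e_period sum_distrib_right[symmetric] by (simp add: fun_eq_iff algebra_simps)
    finally show "((\<lambda>q. regularized_sum N \<epsilon> q * e q) has_integral
        integral {0..real (Suc N)} (\<lambda>x. damped \<epsilon> x * e x) + integral {0..1} (\<lambda>q. r N q * e q)) {0..1}" .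
  qed
  then have "(\<lambda>N. integral {0..1} (\<lambda>q. regularized_sum N \<epsilon> q * e q)) \<longlonglongrightarrow> J + integral {0..1} (\<lambda>q. - Ginf * e q)"
    using tendsto_add[OF main rest] by simp
  from LIMSEQ_unique[OF regularized_integrable_and_limit(2)[OF less_imp_le[OF \<epsilon>], of m, folded e_def] this]
  have "integral {0..1} (\<lambda>q. regularized \<epsilon> q * e q) = J + integral {0..1} (\<lambda>q. - Ginf * e q)" .
  also have "integral {0..1} (\<lambda>q. - Ginf * e q) = - Ginf * (if m = 0 then 1 else 0)"
    using has_integral_mult_right[OF has_integral_cis_period[of "- m"], of "- Ginf"]
    by (intro integral_unique) (simp add: e_def)
  finally show ?thesis by (simp add: J_def Ginf_def e_def)
qed

section \<open>Removal of the damping\<close>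

lemma damped_integral_tendsto_0:
  assumes "\<epsilon> \<longlonglongrightarrow> 0" "\<And>k. \<epsilon> k > 0"
  shows "(\<lambda>k. damped_integral (\<epsilon> k) x) \<longlonglongrightarrow> damped_integral 0 x"
  unfolding damped_integral_def
proof (rule dominated_convergence(2)[OF damped_integrable])
  show "(\<lambda>x. norm (damped 0 x)) integrable_on {0..x}"
    by (intro integrable_continuous_interval continuous_on_norm continuous_on_subset[OF continuous_on_damped]) auto
  show "norm (damped (\<epsilon> k) t) \<le> norm (damped 0 t)" if "t \<in> {0..x}" for k t
    using that norm_damped_le[of t "\<epsilon> k"] assms(2)[of k] by (simp add: norm_damped)
  show "(\<lambda>k. damped (\<epsilon> k) t) \<longlonglongrightarrow> damped 0 t" for t
    unfolding damped_powr_def by (intro tendsto_intros tendsto_exp assms(1))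
qed

text \<open>Tannery's theorem with the majorant \<open>defect_bound\<close> moves the limit inside
  the infinite sum.\<close>

lemma regularized_tendsto_0:
  assumes \<epsilon>: "\<epsilon> \<longlonglongrightarrow> 0" "\<And>k. \<epsilon> k > 0" and q: "q \<ge> 0"
  shows "(\<lambda>k. regularized (\<epsilon> k) q) \<longlonglongrightarrow> regularized 0 q"
proof -
  have h0: "(\<lambda>k. damped (\<epsilon> k) t) \<longlonglongrightarrow> damped 0 t" for t
    unfolding damped_powr_def by (intro tendsto_intros tendsto_exp \<epsilon>(1))
  have T0: "(\<lambda>k. damped_defect (\<epsilon> k) t) \<longlonglongrightarrow> damped_defect 0 t" for t
    unfolding damped_defect_def trapezoid_defect_def by (intro tendsto_intros h0 damped_integral_tendsto_0 \<epsilon>) auto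
  have "(\<lambda>k. \<Sum>n. damped_defect (\<epsilon> k) (q + 1 + real n)) \<longlonglongrightarrow> (\<Sum>n. damped_defect 0 (q + 1 + real n))"
    by (rule tannerys_theorem[THEN conjunct2, THEN conjunct2, OF T0 _ summable_defect_bound])
       (auto intro!: always_eventually damped_defect_le q less_imp_le[OF \<epsilon>(2)])
  then show ?thesis
    unfolding regularized_def by (intro tendsto_intros h0 damped_integral_tendsto_0 \<epsilon>) auto
qed

text \<open>The limit of the damped coefficients. For nonzero m the base is purely imaginary, hence
  off the branch cut, and the power is continuous there.\<close>

definition hurwitz_coeff :: "int \<Rightarrow> complex" where
  "hurwitz_coeff m = (if m = 0 then 0 else of_real (Gamma (p + 1)) * (2 * of_real pi * \<i> * of_int m) powr (- of_real (p + 1)))"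

lemma regularized_0_coefficient: "((\<lambda>q. regularized 0 q * cis (- (2 * pi * of_int m * q))) has_integral hurwitz_coeff m) {0..1}"
proof -
  define \<epsilon> where "\<epsilon> k = inverse (real (Suc k))" for k
  have \<epsilon>: "\<epsilon> \<longlonglongrightarrow> 0" "\<And>k. \<epsilon> k > 0" unfolding \<epsilon>_def by (rule LIMSEQ_inverse_real_of_nat) auto
  have regularized_le: "norm (regularized (\<epsilon> k) q) \<le> 2 + 1 + 4 + suminf defect_bound" if "q \<in> {0..1}" for k q
    using that \<epsilon>(2)[of k] by (intro Lim_norm_ubound[OF _ regularized_sum_tendsto] always_eventually allI regularized_sum_le) auto
  have "(\<lambda>k. integral {0..1} (\<lambda>q. regularized (\<epsilon> k) q * cis (- (2 * pi * of_int m * q))))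
     \<longlonglongrightarrow> integral {0..1} (\<lambda>q. regularized 0 q * cis (- (2 * pi * of_int m * q)))"
  proof (rule dominated_convergence(2)[OF regularized_integrable_and_limit(1)])
    show "(\<lambda>q. 2 + 1 + 4 + suminf defect_bound) integrable_on {0..1::real}" by (rule integrable_on_const) auto
    show "norm (regularized (\<epsilon> k) q * cis (- (2 * pi * of_int m * q))) \<le> 2 + 1 + 4 + suminf defect_bound" if "q \<in> {0..1}" for k q
      using regularized_le[OF that] by (simp add: norm_mult)
    show "(\<lambda>k. regularized (\<epsilon> k) q * cis (- (2 * pi * of_int m * q))) \<longlonglongrightarrow> regularized 0 q * cis (- (2 * pi * of_int m * q))"
      if "q \<in> {0..1}" for q
      using that by (intro tendsto_mult tendsto_const regularized_tendsto_0 \<epsilon>) auto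
  qed (use \<epsilon>(2) in \<open>auto intro: less_imp_le\<close>)
  moreover have "(\<lambda>k. integral {0..1} (\<lambda>q. regularized (\<epsilon> k) q * cis (- (2 * pi * of_int m * q)))) \<longlonglongrightarrow> hurwitz_coeff m"
  proof (cases "m = 0")
    case True
    then show ?thesis using regularized_coefficient[OF \<epsilon>(2), of _ m] by (simp add: hurwitz_coeff_def)
  next
    case False
    have "2 * of_real pi * \<i> * of_int m \<notin> \<real>\<^sub>\<le>\<^sub>0"
      using False by (auto simp: complex_nonpos_Reals_iff)
    moreover have "(\<lambda>k. of_real (\<epsilon> k) + 2 * of_real pi * \<i> * of_int m) \<longlonglongrightarrow> of_real 0 + 2 * of_real pi * \<i> * of_int m"
      by (intro tendsto_intros \<epsilon>)
    ultimately have "(\<lambda>k. (of_real (\<epsilon> k) + 2 * of_real pi * \<i> * of_int m) powr (- of_real (p + 1)))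
       \<longlonglongrightarrow> (2 * of_real pi * \<i> * of_int m) powr (- of_real (p + 1))"
      by (intro tendsto_powr_complex) auto
    then have "(\<lambda>k. of_real (Gamma (p + 1)) * (of_real (\<epsilon> k) + 2 * of_real pi * \<i> * of_int m) powr (- of_real (p + 1)))
       \<longlonglongrightarrow> of_real (Gamma (p + 1)) * (2 * of_real pi * \<i> * of_int m) powr (- of_real (p + 1))"
      by (rule tendsto_mult[OF tendsto_const])
    then show ?thesis using False by (simp only: regularized_coefficient[OF \<epsilon>(2)] hurwitz_coeff_def if_False)
  qed
  ultimately have "integral {0..1} (\<lambda>q. regularized 0 q * cis (- (2 * pi * of_int m * q))) = hurwitz_coeff m"
    by (rule LIMSEQ_unique)
  then show ?thesis using integrable_integral[OF regularized_integrable_and_limit(1)[of 0 m]] by simp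
qed

lemma continuous_on_regularized_0: "continuous_on {0..1} (regularized 0)"
proof -
  have ul: "uniform_limit {0..1} (\<lambda>N q. \<Sum>n<N. damped_defect 0 (q + 1 + real n)) (\<lambda>q. \<Sum>n. damped_defect 0 (q + 1 + real n)) sequentially"
    by (rule Weierstrass_m_test[OF damped_defect_le summable_defect_bound]) auto
  have "continuous_on {0..1} (\<lambda>q. \<Sum>n. damped_defect 0 (q + 1 + real n))"
    by (rule uniform_limit_theorem[OF always_eventually ul])
       (auto simp: damped_defect_def trapezoid_defect_def intro!: continuous_intros continuous_on_damped_compose continuous_on_damped_integral_compose)
  then show ?thesis
    unfolding regularized_def[abs_def] by (intro continuous_intros continuous_on_damped_compose continuous_on_damped_integral_compose) auto
qed

text \<open>Formally the values at q and q + 1 differ by the single summand q^p, which vanishes at q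
  = 0. In the trapezoid form, the first defect is split off the sum and absorbed by the boundary
  terms.\<close>

lemma regularized_0_periodic: "regularized 0 0 = regularized 0 1"
proof -
  have "summable (\<lambda>n. damped_defect 0 (0 + 1 + real n))"
    by (rule summable_comparison_test'[OF summable_defect_bound damped_defect_le]) auto
  from suminf_split_head[OF this]
  have split: "(\<Sum>n. damped_defect 0 (1 + 1 + real n)) = (\<Sum>n. damped_defect 0 (0 + 1 + real n)) - damped_defect 0 1"
    by (simp add: add_ac)
  have T1: "damped_defect 0 1 = (damped 0 1 + damped 0 (1 + 1)) / 2 - (damped_integral 0 (1 + 1) - damped_integral 0 1)"
    by (simp add: damped_defect_def trapezoid_defect_def)
  have "damped 0 0 = 0" using damped_eq[of 0 0] by simp
  then show ?thesis
    unfolding regularized_def split T1 by (simp add: add_divide_distrib)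
qed

lemma norm_hurwitz_coeff: "norm (hurwitz_coeff m) \<le> Gamma (p + 1) * real_of_int \<bar>m\<bar> powr (- (p + 1))"
proof (cases "m = 0")
  case False
  have "norm ((2 * of_real pi * \<i> * of_int m) powr (- of_real (p + 1)) :: complex) = (2 * pi * real_of_int \<bar>m\<bar>) powr (- (p + 1))"
    by (subst norm_powr_real_powr') (auto simp: norm_mult)
  also have "\<dots> \<le> (1 * real_of_int \<bar>m\<bar>) powr (- (p + 1))"
    using False p pi_gt3 by (intro powr_mono2' mult_right_mono) auto
  finally show ?thesis using False Gamma_real_pos[of "p + 1"] p
    by (simp add: hurwitz_coeff_def norm_mult mult_left_mono)
qed (simp add: hurwitz_coeff_def)

lemma regularized_0_series:
  assumes "q \<in> {0..1}"
  shows "regularized 0 q = (\<Sum>n. hurwitz_coeff (int n) * cis (2 * pi * n * q) + hurwitz_coeff (- int n) * cis (- (2 * pi * n * q)))"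
proof (rule Fourier_series_absolutely_convergent[OF continuous_on_regularized_0 regularized_0_periodic regularized_0_coefficient _ _ _ assms])
  have "summable (\<lambda>n. Gamma (p + 1) * real n powr (- (p + 1)))"
    using p by (intro summable_mult) (simp add: summable_real_powr_iff)
  then show "summable (\<lambda>n. norm (hurwitz_coeff (int n)))" "summable (\<lambda>n. norm (hurwitz_coeff (- int n)))"
    by (rule summable_comparison_test', use norm_hurwitz_coeff[of "int _"] norm_hurwitz_coeff[of "- int _"] in simp)+
qed (simp add: hurwitz_coeff_def)

text \<open>The two opposite frequencies combine to 2 r cos \<theta>, where the phase -(p + 1) pi /
  2 is that of i^(-(p + 1)). Its part pi / 2 turns the cosine into sin (2 pi n q - p pi / 2), and
  the addition theorem separates the sine and cosine parts.\<close>

lemma hurwitz_coeff_pair: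
  assumes n: "n > 0"
  shows "hurwitz_coeff (int n) * cis (2 * pi * n * q) + hurwitz_coeff (- int n) * cis (- (2 * pi * n * q)) =
    2 * of_real (Gamma (p + 1)) * of_real (2 * pi) powr (- of_real p - 1) *
      (sin (of_real pi * (- of_real p) / 2) * (of_real (cos (2 * pi * n * q)) * of_nat n powr (- of_real p - 1)) +
       cos (of_real pi * (- of_real p) / 2) * (of_real (sin (2 * pi * n * q)) * of_nat n powr (- of_real p - 1)))"
proof -
  define r where "r = Gamma (p + 1) * (2 * pi) powr (- p - 1) * real n powr (- p - 1)"
  define \<theta> where "\<theta> = 2 * pi * n * q - (p + 1) * (pi / 2)"
  have r_powr: "complex_of_real (2 * pi * n) powr (- of_real (p + 1)) = of_real ((2 * pi) powr (- p - 1) * real n powr (- p - 1))"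
    using powr_of_real[of "2 * pi * n" "- (p + 1)"] n by (simp add: powr_mult)
  have c1: "hurwitz_coeff (int n) = of_real r * cis (- (p + 1) * (pi / 2))"
  proof -
    have "(2 * of_real pi * \<i> * of_int (int n)) powr (- of_real (p + 1)) = (complex_of_real (2 * pi * n) * \<i>) powr (- of_real (p + 1))"
      by (simp add: mult_ac)
    also have "\<dots> = complex_of_real (2 * pi * n) powr (- of_real (p + 1)) * \<i> powr (- of_real (p + 1))"
      using n by (intro powr_times_real_left) auto
    also have "\<i> powr (- of_real (p + 1)) = cis (- (p + 1) * (pi / 2))"
      by (simp add: powr_def cis_conv_exp mult_ac)
    finally have powr_eq: "(2 * of_real pi * \<i> * of_int (int n)) powr (- of_real (p + 1)) = complex_of_real (2 * pi * n) powr (- of_real (p + 1)) * cis (- (p + 1) * (pi / 2))" .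
    show ?thesis using n unfolding hurwitz_coeff_def powr_eq r_powr r_def by simp
  qed
  have c2: "hurwitz_coeff (- int n) = of_real r * cis ((p + 1) * (pi / 2))"
  proof -
    have "(2 * of_real pi * \<i> * of_int (- int n)) powr (- of_real (p + 1)) = (complex_of_real (2 * pi * n) * (- \<i>)) powr (- of_real (p + 1))"
      by (simp add: mult_ac)
    also have "\<dots> = complex_of_real (2 * pi * n) powr (- of_real (p + 1)) * (- \<i>) powr (- of_real (p + 1))"
      using n by (intro powr_times_real_left) auto
    also have "(- \<i>) powr (- of_real (p + 1)) = cis ((p + 1) * (pi / 2))"
      by (simp add: powr_def cis_conv_exp, rule arg_cong[where f = exp], simp add: field_simps)
    finally have powr_eq: "(2 * of_real pi * \<i> * of_int (- int n)) powr (- of_real (p + 1)) = complex_of_real (2 * pi * n) powr (- of_real (p + 1)) * cis ((p + 1) * (pi / 2))" .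
    show ?thesis using n unfolding hurwitz_coeff_def powr_eq r_powr r_def by simp
  qed
  have "hurwitz_coeff (int n) * cis (2 * pi * n * q) + hurwitz_coeff (- int n) * cis (- (2 * pi * n * q)) = of_real r * (cis \<theta> + cis (- \<theta>))"
  proof -
    have "- (p + 1) * (pi / 2) + 2 * pi * n * q = \<theta>" "(p + 1) * (pi / 2) + - (2 * pi * n * q) = - \<theta>"
      by (simp_all add: \<theta>_def field_simps)
    then show ?thesis unfolding c1 c2 by (simp only: mult.assoc[of "of_real r"] cis_mult distrib_left)
  qed
  also have "cis \<theta> + cis (- \<theta>) = of_real (2 * cos \<theta>)" by (simp add: complex_eq_iff)
  also have "cos \<theta> = sin (2 * pi * n * q) * cos (p * pi / 2) - cos (2 * pi * n * q) * sin (p * pi / 2)"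
  proof -
    have "\<theta> = (2 * pi * n * q - p * pi / 2) - pi / 2" by (simp add: \<theta>_def field_simps)
    then have "cos \<theta> = sin (2 * pi * n * q - p * pi / 2)" by (simp add: cos_diff)
    then show ?thesis by (simp add: sin_diff)
  qed
  finally have *: "hurwitz_coeff (int n) * cis (2 * pi * n * q) + hurwitz_coeff (- int n) * cis (- (2 * pi * n * q)) =
     of_real (r * (2 * (sin (2 * pi * n * q) * cos (p * pi / 2) - cos (2 * pi * n * q) * sin (p * pi / 2))))"
    by simp
  have s: "sin (complex_of_real pi * (- of_real p) / 2) = of_real (- sin (p * pi / 2))"
    "cos (complex_of_real pi * (- of_real p) / 2) = of_real (cos (p * pi / 2))"
    using sin_of_real[of "p * pi / 2", where 'a = complex] cos_of_real[of "p * pi / 2", where 'a = complex]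
    by (simp_all add: mult.commute)
  have w: "complex_of_real (2 * pi) powr (- of_real p - 1) = of_real ((2 * pi) powr (- p - 1))"
    "complex_of_nat n powr (- of_real p - 1) = of_real (real n powr (- p - 1))"
    using powr_of_real[of "2 * pi" "- p - 1"] powr_of_real[of "real n" "- p - 1"] by simp_all
  show ?thesis unfolding * s w r_def by (simp add: algebra_simps)
qed

lemma hurwitz_em_eq_regularized_0:
  assumes "q \<ge> 0"
  shows "hurwitz_em (- of_real p) q = regularized 0 q"
proof -
  have F: "complex_of_real x powr (1 - (- of_real p)) / (1 - (- of_real p)) = damped_integral 0 x" if "x \<ge> 0" for x
    using damped_integral_0[OF that] powr_of_real[OF that, of "p + 1"] by (simp add: add.commute)
  have damped: "complex_of_real x powr (- (- of_real p)) = damped 0 x" for x by (simp add: damped_powr_def)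
  have "em_term (- of_real p) x = damped_defect 0 x" if "x \<ge> 0" for x
    using F[of x] F[of "x + 1"] that unfolding em_term_def damped_defect_def trapezoid_defect_def damped by (simp only:)
  then have "(\<Sum>n. em_term (- of_real p) (q + 1 + real n)) = (\<Sum>n. damped_defect 0 (q + 1 + real n))"
    using assms by simp
  moreover have "complex_of_real (q + 1) powr (1 - (- of_real p)) / (- of_real p - 1) = - damped_integral 0 (q + 1)"
    using F[of "q + 1"] assms by (metis add_nonneg_nonneg minus_diff_eq minus_divide_right zero_le_one)
  ultimately show ?thesis unfolding hurwitz_em_def regularized_def damped by simp
qed

lemma hurwitz_em_eq_hurwitz_fourier_real:
  assumes q: "0 < q" "q < 1"
  shows "hurwitz_em (- of_real p) q = hurwitz_fourier (- of_real p) q"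
proof -
  let ?s = "- complex_of_real p"
  let ?t = "\<lambda>n. hurwitz_coeff (int n) * cis (2 * pi * n * q) + hurwitz_coeff (- int n) * cis (- (2 * pi * n * q))"
  have "(\<lambda>n. 2 * of_real (Gamma (p + 1)) * of_real (2 * pi) powr (?s - 1) *
      (sin (of_real pi * ?s / 2) * (of_real (cos (2 * pi * real (Suc n) * q)) * of_nat (Suc n) powr (?s - 1)) +
       cos (of_real pi * ?s / 2) * (of_real (sin (2 * pi * real (Suc n) * q)) * of_nat (Suc n) powr (?s - 1))))
     sums (2 * of_real (Gamma (p + 1)) * of_real (2 * pi) powr (?s - 1) *
      (sin (of_real pi * ?s / 2) * dirichlet_sum (\<lambda>n. cos (2 * pi * n * q)) ?s +
       cos (of_real pi * ?s / 2) * dirichlet_sum (\<lambda>n. sin (2 * pi * n * q)) ?s))"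
    using p by (intro sums_mult sums_add dirichlet_sum_sums) auto
  also have "2 * of_real (Gamma (p + 1)) * of_real (2 * pi) powr (?s - 1) *
      (sin (of_real pi * ?s / 2) * dirichlet_sum (\<lambda>n. cos (2 * pi * n * q)) ?s +
       cos (of_real pi * ?s / 2) * dirichlet_sum (\<lambda>n. sin (2 * pi * n * q)) ?s) = hurwitz_fourier ?s q"
    by (simp add: hurwitz_fourier_def add.commute flip: Gamma_complex_of_real)
  finally have "(\<lambda>n. ?t (Suc n)) sums hurwitz_fourier ?s q"
    by (simp only: hurwitz_coeff_pair[OF zero_less_Suc])
  then have "?t sums (hurwitz_fourier ?s q + ?t 0)" by (subst (asm) sums_Suc_iff)
  then have "?t sums hurwitz_fourier ?s q" by (simp add: hurwitz_coeff_def)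
  then have "regularized 0 q = hurwitz_fourier ?s q" using regularized_0_series[of q] q by (simp add: sums_iff)
  then show ?thesis using hurwitz_em_eq_regularized_0[of q] q by simp
qed

end

section \<open>Identification of the Hurwitz zeta function\<close>

text \<open>Both sides are holomorphic on the connected strip and agree on the real segment (-1, 0),
  which accumulates inside it.\<close>

lemma hurwitz_em_eq_hurwitz_fourier:
  assumes q: "0 < q" "q < 1" and s: "-1 < Re s" "Re s < 0"
  shows "hurwitz_em s q = hurwitz_fourier s q"
proof -
  let ?S = "{s. Re s > -1} \<inter> {s. Re s < 0} :: complex set"
  have "hurwitz_em s q - hurwitz_fourier s q = 0"
  proof (rule analytic_continuation[of "\<lambda>s. hurwitz_em s q - hurwitz_fourier s q" ?S "of_real ` {-1<..<0}" "of_real (-1/2)"])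
    show "(\<lambda>s. hurwitz_em s q - hurwitz_fourier s q) holomorphic_on ?S"
      using q by (intro holomorphic_on_diff holomorphic_on_subset[OF holomorphic_hurwitz_em]
          holomorphic_on_subset[OF holomorphic_hurwitz_fourier]) auto
    show "open ?S" by (intro open_Int open_halfspace_Re_gt open_halfspace_Re_lt)
    show "connected ?S"
      by (intro convex_connected convex_Int convex_halfspace_Re_gt convex_halfspace_Re_lt)
    have "(-1/2::real) islimpt {-1<..<0}" by (simp add: islimpt_greaterThanLessThan1 interior_limit_point)
    then show "complex_of_real (-1/2) islimpt of_real ` {-1<..<0}"
      by (rule islimpt_isCont_image[OF _ linear_continuous_at[OF bounded_linear_of_real]])
         (simp only: of_real_eq_iff eventually_neq_at_within)
    show "hurwitz_em z q - hurwitz_fourier z q = 0" if "z \<in> of_real ` {-1<..<0}" for z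
    proof -
      from that obtain x where "z = of_real x" "-1 < x" "x < 0" by auto
      then show ?thesis using hurwitz_em_eq_hurwitz_fourier_real[of "-x" q] q by simp
    qed
  qed (use s in auto)
  then show ?thesis by simp
qed

text \<open>The given \<open>F\<close> is a witness, so the chosen function has the defining
  property. It agrees with \<open>F\<close> on Re s > 1, and the identity theorem carries this over
  the punctured plane.\<close>

lemma hurwitz_zeta_unique:
  assumes F: "F holomorphic_on - {1}"
    and F_sums: "\<And>s. Re s > 1 \<Longrightarrow> (\<lambda>n. (of_nat n + complex_of_real q) powr (- s)) sums F s"
    and z: "z \<noteq> 1"
  shows "hurwitz_zeta z q = F z"
proof -
  define P where "P F \<longleftrightarrow> F holomorphic_on - {1} \<and>
      (\<forall>s. Re s > 1 \<longrightarrow> (\<lambda>n. (of_nat n + complex_of_real q) powr (- s)) sums F s)" for F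
  have "P F" using F F_sums by (simp add: P_def)
  then have some: "P (SOME F. P F)" by (rule someI[of P F])
  have "(SOME F. P F) z = F z"
  proof (rule analytic_continuation_open[of "{s. Re s > 1}" "- {1}" "SOME F. P F" F])
    show "(SOME F. P F) s = F s" if "s \<in> {s. Re s > 1}" for s
      using some that F_sums[of s] sums_unique2 unfolding P_def by blast
    have "2 \<in> {s :: complex. Re s > 1}" by simp
    then show "{s :: complex. Re s > 1} \<noteq> {}" by blast
    show "connected (- {1 :: complex})" by (intro connected_punctured_universe) auto
  qed (use some F z in \<open>auto simp: P_def open_halfspace_Re_gt\<close>)
  then show ?thesis by (simp add: hurwitz_zeta_def P_def[abs_def])
qed

lemma hurwitz_zeta_continuation:
  assumes q: "0 < q" "q < 1"
  shows "Re z < 0 \<Longrightarrow> hurwitz_zeta z q = hurwitz_fourier z q"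
    and "Re z > -1 \<Longrightarrow> z \<noteq> 1 \<Longrightarrow> hurwitz_zeta z q = hurwitz_em z q"
proof -
  define F where "F s = (if s \<in> {s. Re s < 0} then hurwitz_fourier s q else hurwitz_em s q)" for s
  have "F holomorphic_on {s. Re s < 0} \<union> ({s. Re s > -1} - {1})"
    unfolding F_def
  proof (rule holomorphic_on_If_Un)
    show "open ({s. Re s > -1} - {1 :: complex})" by (intro open_Diff open_halfspace_Re_gt) auto
    show "hurwitz_fourier z q = hurwitz_em z q" if "z \<in> {s. Re s < 0}" "z \<in> {s. Re s > -1} - {1}" for z
      using that q by (simp add: hurwitz_em_eq_hurwitz_fourier)
  qed (use q in \<open>simp_all add: holomorphic_hurwitz_fourier holomorphic_hurwitz_em open_halfspace_Re_lt\<close>)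
  also have "{s. Re s < 0} \<union> ({s. Re s > -1} - {1}) = - {1 :: complex}" by auto
  finally have F: "F holomorphic_on - {1}" .
  have zeta: "hurwitz_zeta z q = F z" if "z \<noteq> 1" for z
  proof (rule hurwitz_zeta_unique[OF F _ that])
    show "(\<lambda>n. (of_nat n + complex_of_real q) powr (- s)) sums F s" if "Re s > 1" for s
      using hurwitz_em_sums[OF q(1) that] that by (simp add: F_def)
  qed
  show "Re z < 0 \<Longrightarrow> hurwitz_zeta z q = hurwitz_fourier z q"
    using zeta[of z] by (cases "z = 1") (auto simp: F_def)
  show "Re z > -1 \<Longrightarrow> z \<noteq> 1 \<Longrightarrow> hurwitz_zeta z q = hurwitz_em z q"
    using zeta[of z] q by (auto simp: F_def hurwitz_em_eq_hurwitz_fourier)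
qed

section \<open>The sawtooth series\<close>

definition sawtooth_sum :: "nat \<Rightarrow> real \<Rightarrow> real" where
  "sawtooth_sum N \<theta> = (\<Sum>n<N. sin (real (Suc n) * \<theta>) / real (Suc n))"

lemma Dirichlet_kernel:
  "2 * sin (\<theta> / 2) * (1/2 + (\<Sum>n<N. cos (real (Suc n) * \<theta>))) = sin ((real N + 1/2) * \<theta>)"
proof (induction N)
  case (Suc N)
  have half: "(real (Suc N) + 1/2) * \<theta> = real (Suc N) * \<theta> + \<theta> / 2" "(real N + 1/2) * \<theta> = real (Suc N) * \<theta> - \<theta> / 2"
    by (simp_all add: field_simps)
  show ?case
    using Suc unfolding half sum.lessThan_Suc by (simp add: sin_add sin_diff ring_distribs del: of_nat_Suc)
qed simp

text \<open>On [0, pi / 3] the cosine is at least 1/2, hence sin y \<ge> y / 2; the double-angle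
  formula carries a weaker linear bound to [0, pi / 2].\<close>

lemma sin_ge_quarter:
  assumes "0 \<le> x" "x \<le> pi / 2"
  shows "sin x \<ge> x / 4"
proof -
  have half: "cos y \<ge> 1/2" if "0 \<le> y" "y \<le> pi / 3" for y
    using cos_monotone_0_pi_le[of y "pi / 3"] that by (simp add: cos_60)
  have "sin 0 - 0 / 2 \<le> sin (x / 2) - (x / 2) / 2"
  proof (rule DERIV_nonneg_imp_nondecreasing[of 0 "x / 2" "\<lambda>y. sin y - y / 2"])
    show "\<exists>d. ((\<lambda>y. sin y - y / 2) has_real_derivative d) (at y) \<and> d \<ge> 0" if "0 \<le> y" "y \<le> x / 2" for y
    proof (intro exI conjI)
      show "((\<lambda>y. sin y - y / 2) has_real_derivative (cos y - 1 / 2)) (at y)"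
        by (auto intro!: derivative_eq_intros)
      show "cos y - 1 / 2 \<ge> 0" using half[of y] that assms by simp
    qed
  qed (use assms in auto)
  then have "x / 4 * (1 / 2) \<le> sin (x / 2) * cos (x / 2)"
    using half[of "x / 2"] assms by (intro mult_mono) auto
  then show ?thesis using sin_double[of "x / 2"] by simp
qed

text \<open>The error is explicit in N and \<theta> together: a fixed \<theta> gives convergence,
  and N \<theta> bounded below gives a uniform bound. The comparison is anchored at pi, where both
  the partial sum and (pi - \<theta>) / 2 vanish.\<close>

lemma sawtooth_sum_approx:
  assumes \<theta>: "0 < \<theta>" "\<theta> \<le> pi"
  shows "\<bar>sawtooth_sum N \<theta> - (pi - \<theta>) / 2\<bar> \<le> 1 / ((real N + 1/2) * sin (\<theta> / 2))"
proof -
  define L where "L = real N + 1/2"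
  have L: "L > 0" by (simp add: L_def)
  define V where "V t = 1 / (2 * L * sin (t / 2))" for t
  \<comment> \<open>The last term of \<open>R\<close> is the boundary term of integrating the Dirichlet kernel by parts. It makes
     \<open>\<bar>R'\<bar> \<le> - V'\<close>, so that \<open>R + V\<close> decreases and \<open>R - V\<close> increases.\<close>
  define R where "R t = sawtooth_sum N t + t / 2 + cos (L * t) * V t" for t
  define V' where "V' t = - cos (t / 2) / (4 * L * (sin (t / 2))\<^sup>2)" for t
  have sin_pos: "sin (t / 2) > 0" if "\<theta> \<le> t" "t \<le> pi" for t
    using that \<theta> by (intro sin_gt_zero) auto
  have dV: "(V has_real_derivative V' t) (at t)" if "\<theta> \<le> t" "t \<le> pi" for t
    unfolding V_def[abs_def] V'_def using sin_pos[OF that] L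
    by (auto intro!: derivative_eq_intros simp: field_simps power2_eq_square)
  have ds: "(sawtooth_sum N has_real_derivative (\<Sum>n<N. cos (real (Suc n) * t))) (at t)" for t
  proof -
    have "((\<lambda>t. sin (real (Suc n) * t) / real (Suc n)) has_real_derivative cos (real (Suc n) * t)) (at t)" for n
    proof -
      have "((\<lambda>t. sin (real (Suc n) * t)) has_real_derivative cos (real (Suc n) * t) * real (Suc n)) (at t)"
        by (rule DERIV_chain2[OF DERIV_sin DERIV_cmult_Id])
      from DERIV_cdivide[OF this, of "real (Suc n)"] show ?thesis by (simp del: of_nat_Suc)
    qed
    then show ?thesis unfolding sawtooth_sum_def[abs_def] by (intro DERIV_sum)
  qed
  have dR: "(R has_real_derivative cos (L * t) * V' t) (at t)" if "\<theta> \<le> t" "t \<le> pi" for t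
  proof -
    have dcos: "((\<lambda>t. cos (L * t)) has_real_derivative - sin (L * t) * L) (at t)"
      by (rule DERIV_chain2[OF DERIV_cos DERIV_cmult_Id])
    have dhalf: "((\<lambda>t. t / 2) has_real_derivative 1 / 2) (at t)"
      by (rule DERIV_cdivide[OF DERIV_ident])
    have "(R has_real_derivative (\<Sum>n<N. cos (real (Suc n) * t)) + 1 / 2 + ((- sin (L * t) * L) * V t + V' t * cos (L * t))) (at t)"
      unfolding R_def[abs_def] by (intro DERIV_add ds dhalf DERIV_mult dcos dV that)
    \<comment> \<open>The Dirichlet kernel cancels the term from differentiating cos (L t), which
      leaves only cos (L t) V' t.\<close>
    moreover have "(\<Sum>n<N. cos (real (Suc n) * t)) + 1 / 2 = sin (L * t) * L * V t"
      using Dirichlet_kernel[of t N] sin_pos[OF that] L by (simp add: V_def L_def[symmetric] field_simps)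
    ultimately show ?thesis by (simp add: mult.commute)
  qed
  have V'_le: "V' t \<le> 0" if "\<theta> \<le> t" "t \<le> pi" for t
    using that \<theta> L cos_ge_zero[of "t / 2"] unfolding V'_def by (auto intro!: divide_nonpos_nonneg)
  have "R pi + V pi \<le> R \<theta> + V \<theta>"
  proof (rule DERIV_nonpos_imp_nonincreasing[of \<theta> pi "\<lambda>t. R t + V t"])
    fix t assume t: "\<theta> \<le> t" "t \<le> pi"
    have "cos (L * t) * V' t + V' t = (cos (L * t) + 1) * V' t" by (simp add: ring_distribs)
    also have "\<dots> \<le> 0" using V'_le[OF t] cos_ge_minus_one[of "L * t"] by (intro mult_nonneg_nonpos) linarith+
    finally show "\<exists>d. ((\<lambda>t. R t + V t) has_real_derivative d) (at t) \<and> d \<le> 0"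
      using DERIV_add[OF dR[OF t] dV[OF t]] by blast
  qed (use \<theta> in auto)
  moreover have "R \<theta> - V \<theta> \<le> R pi - V pi"
  proof (rule DERIV_nonneg_imp_nondecreasing[of \<theta> pi "\<lambda>t. R t - V t"])
    fix t assume t: "\<theta> \<le> t" "t \<le> pi"
    have "cos (L * t) * V' t - V' t = (cos (L * t) - 1) * V' t" by (simp add: ring_distribs)
    also have "\<dots> \<ge> 0" using V'_le[OF t] cos_le_one[of "L * t"] by (intro mult_nonpos_nonpos) linarith+
    finally show "\<exists>d. ((\<lambda>t. R t - V t) has_real_derivative d) (at t) \<and> d \<ge> 0"
      using DERIV_diff[OF dR[OF t] dV[OF t]] by blast
  qed (use \<theta> in auto)
  moreover have "R pi = pi / 2"
  proof -
    have "cos (L * pi) = cos (real N * pi + pi / 2)" by (simp add: L_def field_simps)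
    also have "\<dots> = 0" by (simp add: cos_add)
    finally have "cos (L * pi) = 0" .
    moreover have "sawtooth_sum N pi = 0" unfolding sawtooth_sum_def by (simp only: sin_npi) simp
    ultimately show ?thesis by (simp add: R_def)
  qed
  moreover have "V pi > 0" using L by (simp add: V_def)
  ultimately have "\<bar>R \<theta> - pi / 2\<bar> \<le> V \<theta>" by linarith
  \<comment> \<open>Removing the boundary term from R \<theta> costs a second V \<theta>, hence the
    factor 2 in the final bound.\<close>
  moreover have "\<bar>cos (L * \<theta>) * V \<theta>\<bar> \<le> 1 * V \<theta>"
    unfolding abs_mult using sin_pos[of \<theta>] \<theta> L by (intro mult_mono) (auto simp: V_def)
  moreover have "sawtooth_sum N \<theta> - (pi - \<theta>) / 2 = (R \<theta> - pi / 2) - cos (L * \<theta>) * V \<theta>"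
    by (simp add: R_def field_simps)
  ultimately have "\<bar>sawtooth_sum N \<theta> - (pi - \<theta>) / 2\<bar> \<le> 2 * V \<theta>"
    using abs_triangle_ineq4[of "R \<theta> - pi / 2" "cos (L * \<theta>) * V \<theta>"] by linarith
  also have "2 * V \<theta> = 1 / ((real N + 1/2) * sin (\<theta> / 2))" by (simp add: V_def flip: L_def)
  finally show ?thesis .
qed

lemma sawtooth_sum_reflect: "sawtooth_sum N (2 * pi - \<theta>) = - sawtooth_sum N \<theta>"
proof -
  have "sin (real (Suc n) * (2 * pi - \<theta>)) = - sin (real (Suc n) * \<theta>)" for n
  proof -
    have "real (Suc n) * (2 * pi - \<theta>) = of_int (int (Suc n)) * (2 * pi) - real (Suc n) * \<theta>" by (simp add: algebra_simps)
    then show ?thesis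
      using sin_int_2pin[of "int (Suc n)"] cos_int_2pin[of "int (Suc n)"]
      by (simp add: sin_diff mult_ac)
  qed
  then show ?thesis unfolding sawtooth_sum_def by (simp add: sum_negf del: of_nat_Suc)
qed

lemma sawtooth_sum_tendsto:
  assumes "0 < \<theta>" "\<theta> < 2 * pi"
  shows "(\<lambda>N. sawtooth_sum N \<theta>) \<longlonglongrightarrow> (pi - \<theta>) / 2"
proof -
  have *: "(\<lambda>N. sawtooth_sum N \<theta>) \<longlonglongrightarrow> (pi - \<theta>) / 2" if \<theta>: "0 < \<theta>" "\<theta> \<le> pi" for \<theta>
  proof (rule LIM_zero_cancel, rule Lim_null_comparison)
    show "eventually (\<lambda>N. norm (sawtooth_sum N \<theta> - (pi - \<theta>) / 2) \<le> 1 / ((real N + 1/2) * sin (\<theta> / 2))) sequentially"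
      using sawtooth_sum_approx[OF \<theta>] by simp
    have "sin (\<theta> / 2) > 0" using \<theta> by (intro sin_gt_zero) auto
    moreover have "filterlim (\<lambda>N. real N + 1/2) at_top sequentially"
      using filterlim_tendsto_add_at_top[OF tendsto_const[of "1/2 :: real"] filterlim_real_sequentially]
      by (simp add: add.commute)
    ultimately have "filterlim (\<lambda>N. (real N + 1/2) * sin (\<theta> / 2)) at_top sequentially"
      by (intro filterlim_at_top_mult_tendsto_pos[OF tendsto_const])
    then show "(\<lambda>N. 1 / ((real N + 1/2) * sin (\<theta> / 2))) \<longlonglongrightarrow> 0"
      by (intro real_tendsto_divide_at_top[OF tendsto_const])
  qed
  show ?thesis
  proof (cases "\<theta> \<le> pi")
    case False
    have "(\<lambda>N. - sawtooth_sum N (2 * pi - \<theta>)) \<longlonglongrightarrow> - ((pi - (2 * pi - \<theta>)) / 2)"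
      using False assms by (intro tendsto_minus *) auto
    moreover have "- ((pi - (2 * pi - \<theta>)) / 2) = (pi - \<theta>) / 2" by (simp add: field_simps)
    ultimately show ?thesis by (simp only: sawtooth_sum_reflect minus_minus)
  qed (use * assms in auto)
qed

text \<open>If N \<theta> \<le> 1, then |sin x| \<le> |x| bounds the sum by N \<theta>. Otherwise,
  for \<theta> up to pi, the error estimate gives 8 and the limit is at most 2 in size, together 10.
  Reflection covers \<theta> beyond pi.\<close>

lemma sawtooth_sum_bounded:
  assumes "0 < \<theta>" "\<theta> < 2 * pi"
  shows "\<bar>sawtooth_sum N \<theta>\<bar> \<le> 10"
proof -
  have *: "\<bar>sawtooth_sum N \<theta>\<bar> \<le> 10" if \<theta>: "0 < \<theta>" "\<theta> \<le> pi" for \<theta>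
  proof (cases "real N * \<theta> \<le> 1")
    case True
    have "\<bar>sawtooth_sum N \<theta>\<bar> \<le> (\<Sum>n<N. \<theta>)"
      unfolding sawtooth_sum_def
    proof (rule order_trans[OF sum_abs], rule sum_mono)
      fix n
      have "\<bar>sin (real (Suc n) * \<theta>)\<bar> \<le> real (Suc n) * \<theta>"
        using abs_sin_x_le_abs_x[of "real (Suc n) * \<theta>"] \<theta> by simp
      then show "\<bar>sin (real (Suc n) * \<theta>) / real (Suc n)\<bar> \<le> \<theta>"
        by (simp add: abs_divide divide_le_eq mult.commute del: of_nat_Suc)
    qed
    then show ?thesis using True by simp
  next
    case False
    have "sin (\<theta> / 2) \<ge> \<theta> / 8" using sin_ge_quarter[of "\<theta> / 2"] \<theta> by simp
    then have "(real N + 1/2) * sin (\<theta> / 2) \<ge> real N * (\<theta> / 8)"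
      using \<theta> by (intro mult_mono) auto
    then have "1 / ((real N + 1/2) * sin (\<theta> / 2)) \<le> 1 / (1 / 8)"
      using False by (intro divide_left_mono) auto
    with sawtooth_sum_approx[OF \<theta>, of N] have "\<bar>sawtooth_sum N \<theta> - (pi - \<theta>) / 2\<bar> \<le> 8" by simp
    moreover have "\<bar>(pi - \<theta>) / 2\<bar> \<le> 2" using \<theta> pi_less_4 by simp
    ultimately show ?thesis by linarith
  qed
  show ?thesis
  proof (cases "\<theta> \<le> pi")
    case False
    then show ?thesis using *[of "2 * pi - \<theta>"] assms by (simp add: sawtooth_sum_reflect)
  qed (use * assms in auto)
qed

section \<open>Partial sums of Hurwitz's series for real z, including z = 0\<close>

definition hurwitz_series_term :: "real \<Rightarrow> nat \<Rightarrow> real \<Rightarrow> real" where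
  "hurwitz_series_term z n q = real (Suc n) powr (z - 1) *
     (sin (pi * z / 2) * cos (2 * pi * q * real (Suc n)) + cos (pi * z / 2) * sin (2 * pi * q * real (Suc n)))"

lemma hurwitz_series_term_0:
  "(\<Sum>n<N. hurwitz_series_term 0 n q) = sawtooth_sum N (2 * pi * q)"
  unfolding sawtooth_sum_def
proof (rule sum.cong[OF refl])
  fix n
  have "real (Suc n) powr (0 - 1) = 1 / real (Suc n)"
    using powr_minus_divide[of "real (Suc n)" 1] by simp
  then show "hurwitz_series_term 0 n q = sin (real (Suc n) * (2 * pi * q)) / real (Suc n)"
    unfolding hurwitz_series_term_def mult.commute[of "real (Suc n)" "2 * pi * q"]
    by (simp del: of_nat_Suc)
qed

text \<open>For z < 0 the terms have a summable majorant; at z = 0 that majorant would be harmonic,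
  and the sawtooth bound is used instead.\<close>

lemma hurwitz_series_partial_sums_bounded:
  assumes z: "z \<le> 0"
  obtains B where "\<And>N q. 0 < q \<Longrightarrow> q < 1 \<Longrightarrow> \<bar>\<Sum>n<N. hurwitz_series_term z n q\<bar> \<le> B"
proof (cases "z = 0")
  case True
  show ?thesis
    by (rule that[of 10]) (use sawtooth_sum_bounded in \<open>simp add: True hurwitz_series_term_0\<close>)
next
  case False
  have le: "\<bar>hurwitz_series_term z n q\<bar> \<le> real (Suc n) powr (z - 1) * 2" for n q
    unfolding hurwitz_series_term_def abs_mult
  proof (intro mult_mono)
    have "\<bar>sin (pi * z / 2) * cos (2 * pi * q * real (Suc n))\<bar> \<le> 1 * 1"
      "\<bar>cos (pi * z / 2) * sin (2 * pi * q * real (Suc n))\<bar> \<le> 1 * 1"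
      unfolding abs_mult by (intro mult_mono abs_sin_le_one abs_cos_le_one; simp)+
    then show "\<bar>sin (pi * z / 2) * cos (2 * pi * q * real (Suc n)) + cos (pi * z / 2) * sin (2 * pi * q * real (Suc n))\<bar> \<le> 2"
      by linarith
  qed auto
  have sum: "summable (\<lambda>n. real (Suc n) powr (z - 1) * 2)"
    using False z by (intro summable_mult2 summable_Suc_powr) auto
  show ?thesis
  proof (rule that)
    fix N q
    have "\<bar>\<Sum>n<N. hurwitz_series_term z n q\<bar> \<le> (\<Sum>n<N. real (Suc n) powr (z - 1) * 2)"
      by (rule order_trans[OF sum_abs]) (intro sum_mono le)
    also have "\<dots> \<le> (\<Sum>n. real (Suc n) powr (z - 1) * 2)" by (intro sum_le_suminf sum) auto
    finally show "\<bar>\<Sum>n<N. hurwitz_series_term z n q\<bar> \<le> (\<Sum>n. real (Suc n) powr (z - 1) * 2)" .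
  qed
qed

lemma hurwitz_zeta_series:
  assumes z: "z \<le> 0" and q: "0 < q" "q < 1"
  shows "(\<lambda>n. complex_of_real (2 * Gamma (1 - z) / (2 * pi) powr (1 - z) * hurwitz_series_term z n q))
           sums hurwitz_zeta (of_real z) q"
proof (cases "z = 0")
  case True
  \<comment> \<open>The trapezoid rule is exact for constants, so at z = 0 only 1 + 1/2 - (q + 1) =
    1/2 - q remains of \<open>hurwitz_em\<close>.\<close>
  have "em_term 0 x = 0" if "x > 0" for x
    using that by (simp add: em_term_def trapezoid_defect_def)
  moreover have "complex_of_real (q + 1) \<noteq> 0"
    unfolding of_real_eq_0_iff using q by simp
  ultimately have "hurwitz_zeta 0 q = of_real (1/2 - q)"
    using hurwitz_zeta_continuation(2)[OF q, of 0] q by (simp add: hurwitz_em_def)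
  moreover have "(\<lambda>N. complex_of_real (1 / pi * sawtooth_sum N (2 * pi * q))) \<longlonglongrightarrow> complex_of_real (1 / pi * ((pi - 2 * pi * q) / 2))"
    using q by (intro tendsto_intros sawtooth_sum_tendsto) auto
  moreover have "1 / pi * ((pi - 2 * pi * q) / 2) = 1/2 - q" by (simp add: field_simps)
  moreover have "(\<Sum>n<N. complex_of_real (2 * Gamma (1 - 0) / (2 * pi) powr (1 - 0) * hurwitz_series_term 0 n q)) =
      complex_of_real (1 / pi * sawtooth_sum N (2 * pi * q))" for N
  proof -
    have "2 * Gamma (1 - 0) / (2 * pi) powr (1 - 0) = 1 / pi" by simp
    then show ?thesis by (simp only: of_real_sum[symmetric] sum_distrib_left[symmetric] hurwitz_series_term_0)
  qed
  ultimately show ?thesis by (simp only: True sums_def of_real_0)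
next
  case False
  let ?s = "complex_of_real z"
  have neg: "Re ?s < 0" using False z by simp
  have "(\<lambda>n. 2 * Gamma (1 - ?s) * of_real (2 * pi) powr (?s - 1) *
      (sin (of_real pi * ?s / 2) * (of_real (cos (2 * pi * real (Suc n) * q)) * of_nat (Suc n) powr (?s - 1)) +
       cos (of_real pi * ?s / 2) * (of_real (sin (2 * pi * real (Suc n) * q)) * of_nat (Suc n) powr (?s - 1))))
     sums hurwitz_fourier ?s q"
    unfolding hurwitz_fourier_def using neg by (intro sums_mult sums_add dirichlet_sum_sums) auto
  also have "hurwitz_fourier ?s q = hurwitz_zeta ?s q"
    using hurwitz_zeta_continuation(1)[OF q neg] by simp
  also have "(\<lambda>n. 2 * Gamma (1 - ?s) * of_real (2 * pi) powr (?s - 1) *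
      (sin (of_real pi * ?s / 2) * (of_real (cos (2 * pi * real (Suc n) * q)) * of_nat (Suc n) powr (?s - 1)) +
       cos (of_real pi * ?s / 2) * (of_real (sin (2 * pi * real (Suc n) * q)) * of_nat (Suc n) powr (?s - 1))))
    = (\<lambda>n. complex_of_real (2 * Gamma (1 - z) / (2 * pi) powr (1 - z) * hurwitz_series_term z n q))"
  proof
    fix n
    have 1: "complex_of_real (2 * pi) powr (?s - 1) = of_real (1 / (2 * pi) powr (1 - z))"
      using powr_of_real[of "2 * pi" "z - 1"] powr_minus[of "2 * pi" "1 - z"] by (simp add: inverse_eq_divide)
    have 2: "of_nat (Suc n) powr (?s - 1) = complex_of_real (real (Suc n) powr (z - 1))"
      using powr_of_real[of "real (Suc n)" "z - 1"] by simp
    have 3: "Gamma (1 - ?s) = of_real (Gamma (1 - z))" by (simp flip: Gamma_complex_of_real)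
    have 4: "sin (of_real pi * ?s / 2) = of_real (sin (pi * z / 2))" "cos (of_real pi * ?s / 2) = of_real (cos (pi * z / 2))"
      by (simp_all flip: sin_of_real cos_of_real)
    show "2 * Gamma (1 - ?s) * of_real (2 * pi) powr (?s - 1) *
      (sin (of_real pi * ?s / 2) * (of_real (cos (2 * pi * real (Suc n) * q)) * of_nat (Suc n) powr (?s - 1)) +
       cos (of_real pi * ?s / 2) * (of_real (sin (2 * pi * real (Suc n) * q)) * of_nat (Suc n) powr (?s - 1)))
      = complex_of_real (2 * Gamma (1 - z) / (2 * pi) powr (1 - z) * hurwitz_series_term z n q)"
      unfolding 1 2 3 4 hurwitz_series_term_def by (simp add: algebra_simps del: of_nat_Suc)
  qed
  finally show ?thesis .
qed

section \<open>Limits under the integral against an integrable factor\<close>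

lemma absolutely_integrable_mult_bounded_continuous:
  fixes f k :: "real \<Rightarrow> complex"
  assumes f: "f absolutely_integrable_on {a..b}" and k: "continuous_on {a..b} k"
  shows "(\<lambda>x. f x * k x) absolutely_integrable_on {a..b}"
proof -
  have "(\<lambda>x. k x * f x) absolutely_integrable_on {a..b}"
  proof (rule absolutely_integrable_bounded_measurable_product[OF bilinear_times _ _ _ f])
    show "k \<in> borel_measurable (lebesgue_on {a..b})"
      using k by (intro continuous_imp_measurable_on_sets_lebesgue) auto
    show "bounded (k ` {a..b})"
      using k by (intro compact_imp_bounded compact_continuous_image) auto
  qed auto
  then show ?thesis by (simp add: mult.commute)
qed

text \<open>Convergence and the bound are asked only on the open interval: at the endpoints one of q
  and 1 - q is 0, where the zeta function is not meaningful. The endpoints are a null set, so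
  dominated convergence on the interior suffices.\<close>

lemma integral_mult_bounded_limit:
  fixes f k :: "real \<Rightarrow> complex" and K :: "nat \<Rightarrow> real \<Rightarrow> complex"
  assumes f: "f absolutely_integrable_on {a..b}"
    and K: "\<And>N. continuous_on {a..b} (K N)"
    and lim: "\<And>x. x \<in> {a<..<b} \<Longrightarrow> (\<lambda>N. K N x) \<longlonglongrightarrow> k x"
    and bound: "\<And>N x. x \<in> {a<..<b} \<Longrightarrow> norm (K N x) \<le> B"
  shows "(\<lambda>x. f x * k x) absolutely_integrable_on {a..b}"
    and "(\<lambda>N. LINT x:{a..b}|lebesgue. f x * K N x) \<longlonglongrightarrow> (LINT x:{a..b}|lebesgue. f x * k x)"
proof -
  have fK: "(\<lambda>x. f x * K N x) absolutely_integrable_on {a..b}" for N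
    by (rule absolutely_integrable_mult_bounded_continuous[OF f K])
  have fK': "(\<lambda>x. f x * K N x) absolutely_integrable_on {a<..<b}" for N
    using fK by (simp add: absolutely_integrable_on_Icc_iff_Ioo)
  have h: "(\<lambda>x. norm (f x) * B) integrable_on {a<..<b}"
    using f[unfolded absolutely_integrable_on_Icc_iff_Ioo]
    unfolding absolutely_integrable_on_def by (intro integrable_on_mult_left) auto
  have le: "norm (f x * K N x) \<le> norm (f x) * B" if "x \<in> {a<..<b}" for N x
    using bound[OF that] by (simp add: norm_mult mult_left_mono)
  have tends: "(\<lambda>N. f x * K N x) \<longlonglongrightarrow> f x * k x" if "x \<in> {a<..<b}" for x
    by (intro tendsto_mult tendsto_const lim that)
  have "(\<lambda>x. f x * k x) absolutely_integrable_on {a<..<b}"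
  proof (rule dominated_convergence_absolutely_integrable[OF fK' h _ tends])
    show "norm (f x * k x) \<le> norm (f x) * B" if "x \<in> {a<..<b}" for x
      using Lim_norm_ubound[OF _ tends[OF that]] le[OF that] by auto
  qed
  then show fk: "(\<lambda>x. f x * k x) absolutely_integrable_on {a..b}"
    by (simp add: absolutely_integrable_on_Icc_iff_Ioo)
  have "(\<lambda>N. integral {a<..<b} (\<lambda>x. f x * K N x)) \<longlonglongrightarrow> integral {a<..<b} (\<lambda>x. f x * k x)"
    by (rule dominated_convergence(2)[OF set_lebesgue_integral_eq_integral(1)[OF fK'] h le tends])
  then show "(\<lambda>N. LINT x:{a..b}|lebesgue. f x * K N x) \<longlonglongrightarrow> (LINT x:{a..b}|lebesgue. f x * k x)"
    unfolding set_lebesgue_integral_eq_integral(2)[OF fK] set_lebesgue_integral_eq_integral(2)[OF fk]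
      integral_open_interval_real .
qed

section \<open>Termwise integration\<close>

text \<open>The factor 2 of the kernel is absorbed by the 2 in the coefficient formulas. Keeping s
  and t free lets one identity cover both q and 1 - q, whose kernels differ in the sign of the sine
  part.\<close>

lemma integral_mult_trigonometric_sum:
  fixes f :: "real \<Rightarrow> complex" and \<alpha> \<beta> :: "nat \<Rightarrow> complex" and \<kappa> s t :: real
  assumes f: "f absolutely_integrable_on {0..1}"
    and \<alpha>: "\<And>n. n \<ge> 1 \<Longrightarrow> \<alpha> n = 2 * (LINT q:{0..1}|lebesgue. f q * complex_of_real (cos (2 * pi * q * real n)))"
    and \<beta>: "\<And>n. n \<ge> 1 \<Longrightarrow> \<beta> n = 2 * (LINT q:{0..1}|lebesgue. f q * complex_of_real (sin (2 * pi * q * real n)))"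
  shows "(LINT q:{0..1}|lebesgue. f q * (\<Sum>n<N. complex_of_real (2 * \<kappa> * (real (Suc n) powr (z - 1) *
            (s * cos (2 * pi * q * real (Suc n)) + t * sin (2 * pi * q * real (Suc n))))))) =
    of_real \<kappa> * (of_real s * (\<Sum>n<N. \<alpha> (Suc n) / of_real (real (Suc n) powr (1 - z))) +
                  of_real t * (\<Sum>n<N. \<beta> (Suc n) / of_real (real (Suc n) powr (1 - z))))"
proof -
  let ?c = "\<lambda>n q. complex_of_real (cos (2 * pi * q * real (Suc n)))"
  let ?s = "\<lambda>n q. complex_of_real (sin (2 * pi * q * real (Suc n)))"
  let ?r = "\<lambda>n. complex_of_real (real (Suc n) powr (1 - z))"
  let ?K = "\<lambda>q. \<Sum>n<N. complex_of_real (2 * \<kappa> * (real (Suc n) powr (z - 1) *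
            (s * cos (2 * pi * q * real (Suc n)) + t * sin (2 * pi * q * real (Suc n)))))"
  have c: "((\<lambda>q. f q * ?c n q) has_integral \<alpha> (Suc n) / 2) {0..1}" for n
    using has_integral_set_lebesgue[OF absolutely_integrable_mult_bounded_continuous[OF f, of "?c n"]] \<alpha>[of "Suc n"]
    by (simp add: continuous_intros)
  have s: "((\<lambda>q. f q * ?s n q) has_integral \<beta> (Suc n) / 2) {0..1}" for n
    using has_integral_set_lebesgue[OF absolutely_integrable_mult_bounded_continuous[OF f, of "?s n"]] \<beta>[of "Suc n"]
    by (simp add: continuous_intros)
  have "((\<lambda>q. \<Sum>n<N. (2 * of_real \<kappa> * of_real s / ?r n) * (f q * ?c n q) + (2 * of_real \<kappa> * of_real t / ?r n) * (f q * ?s n q)) has_integral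
      (\<Sum>n<N. (2 * of_real \<kappa> * of_real s / ?r n) * (\<alpha> (Suc n) / 2) + (2 * of_real \<kappa> * of_real t / ?r n) * (\<beta> (Suc n) / 2))) {0..1}"
    by (intro has_integral_sum has_integral_add has_integral_mult_right c s) auto
  also have "(\<lambda>q. \<Sum>n<N. (2 * of_real \<kappa> * of_real s / ?r n) * (f q * ?c n q) + (2 * of_real \<kappa> * of_real t / ?r n) * (f q * ?s n q)) = (\<lambda>q. f q * ?K q)"
  proof
    fix q
    have "(2 * of_real \<kappa> * of_real s / ?r n) * (f q * ?c n q) + (2 * of_real \<kappa> * of_real t / ?r n) * (f q * ?s n q) =
       f q * complex_of_real (2 * \<kappa> * (real (Suc n) powr (z - 1) *
            (s * cos (2 * pi * q * real (Suc n)) + t * sin (2 * pi * q * real (Suc n)))))" for n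
    proof -
      have "real (Suc n) powr (z - 1) = inverse (real (Suc n) powr (1 - z))"
        using powr_minus[of "real (Suc n)" "1 - z"] by simp
      then show ?thesis by (simp add: divide_inverse algebra_simps del: of_nat_Suc)
    qed
    then show "(\<Sum>n<N. (2 * of_real \<kappa> * of_real s / ?r n) * (f q * ?c n q) + (2 * of_real \<kappa> * of_real t / ?r n) * (f q * ?s n q)) = f q * ?K q"
      by (simp only: sum_distrib_left)
  qed
  also have "(\<Sum>n<N. (2 * of_real \<kappa> * of_real s / ?r n) * (\<alpha> (Suc n) / 2) + (2 * of_real \<kappa> * of_real t / ?r n) * (\<beta> (Suc n) / 2)) =
    of_real \<kappa> * (of_real s * (\<Sum>n<N. \<alpha> (Suc n) / ?r n) + of_real t * (\<Sum>n<N. \<beta> (Suc n) / ?r n))"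
    by (simp add: sum.distrib sum_distrib_left distrib_left mult.assoc del: of_nat_Suc)
  finally have int: "((\<lambda>q. f q * ?K q) has_integral
    of_real \<kappa> * (of_real s * (\<Sum>n<N. \<alpha> (Suc n) / ?r n) + of_real t * (\<Sum>n<N. \<beta> (Suc n) / ?r n))) {0..1}" .
  have "(\<lambda>q. f q * ?K q) absolutely_integrable_on {0..1}"
    by (intro absolutely_integrable_mult_bounded_continuous[OF f] continuous_intros)
  from set_lebesgue_integral_eq_integral(2)[OF this] int show ?thesis
    by (simp only: integral_unique)
qed

text \<open>This bounds all Fourier coefficients by a common constant, which for z < 0 already makes
  both coefficient series absolutely convergent.\<close>

lemma norm_set_integral_mult_le:
  fixes f :: "real \<Rightarrow> complex"
  assumes f: "f absolutely_integrable_on {0..1}" and g: "continuous_on {0..1} g" and le: "\<And>q. \<bar>g q\<bar> \<le> 1"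
  shows "norm (LINT q:{0..1}|lebesgue. f q * complex_of_real (g q)) \<le> integral {0..1} (\<lambda>q. norm (f q))"
proof -
  have fg: "(\<lambda>q. f q * complex_of_real (g q)) absolutely_integrable_on {0..1}"
    by (intro absolutely_integrable_mult_bounded_continuous[OF f] continuous_intros g)
  show ?thesis
    unfolding set_lebesgue_integral_eq_integral(2)[OF fg]
  proof (rule integral_norm_bound_integral)
    show "(\<lambda>q. norm (f q)) integrable_on {0..1}" using f by (simp add: absolutely_integrable_on_def)
    show "norm (f q * complex_of_real (g q)) \<le> norm (f q)" for q
      using mult_left_mono[OF le[of q] norm_ge_zero[of "f q"]] by (simp add: norm_mult)
  qed (rule set_lebesgue_integral_eq_integral(1)[OF fg])
qed

lemma summable_div_Suc_powr:
  fixes x :: "nat \<Rightarrow> complex"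
  assumes x: "\<And>n. n \<ge> 1 \<Longrightarrow> norm (x n) \<le> C" and z: "z < 0"
  shows "summable (\<lambda>n. x (Suc n) / complex_of_real (real (Suc n) powr (1 - z)))"
proof (rule summable_comparison_test')
  show "summable (\<lambda>n. C * real (Suc n) powr (z - 1))"
    using z by (intro summable_mult summable_Suc_powr) auto
  fix n :: nat
  have "real (Suc n) powr (z - 1) = inverse (real (Suc n) powr (1 - z))"
    using powr_minus[of "real (Suc n)" "1 - z"] by simp
  then have "norm (x (Suc n) / complex_of_real (real (Suc n) powr (1 - z))) = norm (x (Suc n)) * real (Suc n) powr (z - 1)"
    unfolding norm_divide norm_of_real by (simp add: divide_inverse del: of_nat_Suc)
  also have "\<dots> \<le> C * real (Suc n) powr (z - 1)" using x by (intro mult_right_mono) auto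
  finally show "norm (x (Suc n) / complex_of_real (real (Suc n) powr (1 - z))) \<le> C * real (Suc n) powr (z - 1)" .
qed

text \<open>The minus sign is attached to the cosine coefficient to match the shape s cos + t sin of
  \<open>integral_mult_trigonometric_sum\<close>.\<close>

lemma hurwitz_series_term_reflect:
  "hurwitz_series_term z n (1 - q) = real (Suc n) powr (z - 1) *
     (sin (pi * z / 2) * cos (2 * pi * q * real (Suc n)) + (- cos (pi * z / 2)) * sin (2 * pi * q * real (Suc n)))"
proof -
  have "2 * pi * (1 - q) * real (Suc n) = of_int (int (Suc n)) * (2 * pi) - 2 * pi * q * real (Suc n)"
    by (simp add: algebra_simps)
  then have "cos (2 * pi * (1 - q) * real (Suc n)) = cos (2 * pi * q * real (Suc n))"
    "sin (2 * pi * (1 - q) * real (Suc n)) = - sin (2 * pi * q * real (Suc n))"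
    using sin_int_2pin[of "int (Suc n)"] cos_int_2pin[of "int (Suc n)"]
    by (simp_all add: sin_diff cos_diff mult.commute[of _ "2 * pi"] del: of_nat_Suc)
  then show ?thesis by (simp add: hurwitz_series_term_def del: of_nat_Suc)
qed

text \<open>At z = 0 the series \<open>A\<close> may diverge; its \<open>suminf\<close> is then an
  unspecified value, which the factor sin 0 = 0 removes. Summability of \<open>A\<close> is
  therefore asserted only for z < 0, that of \<open>B\<close> throughout.\<close>

theorem theorem2p2:
  fixes f :: "'w \<Rightarrow> real \<Rightarrow> complex"
    and a b :: "nat \<Rightarrow> 'w \<Rightarrow> complex"
    and w :: 'w
    and z :: real
  assumes f_int: "f w absolutely_integrable_on {0..1}"
    and a0: "a 0 w = (LINT q:{0..1}|lebesgue. f w q)"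
    and a: "\<And>n. n \<ge> 1 \<Longrightarrow>
      a n w = 2 * (LINT q:{0..1}|lebesgue. f w q * complex_of_real (cos (2 * pi * q * real n)))"
    and b: "\<And>n. n \<ge> 1 \<Longrightarrow>
      b n w = 2 * (LINT q:{0..1}|lebesgue. f w q * complex_of_real (sin (2 * pi * q * real n)))"
    and z: "z \<le> 0"
  defines "A \<equiv> (\<lambda>n. a (Suc n) w / complex_of_real (real (Suc n) powr (1 - z)))"
    and "B \<equiv> (\<lambda>n. b (Suc n) w / complex_of_real (real (Suc n) powr (1 - z)))"
  shows "(z < 0 \<longrightarrow> summable A) \<and> summable B \<and>
    (\<lambda>q. f w q * hurwitz_zeta (complex_of_real z) q) absolutely_integrable_on {0..1} \<and>
    (\<lambda>q. f w q * hurwitz_zeta (complex_of_real z) (1 - q)) absolutely_integrable_on {0..1} \<and>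
    (LINT q:{0..1}|lebesgue. f w q * hurwitz_zeta (complex_of_real z) q) =
      complex_of_real (Gamma (1 - z) / (2 * pi) powr (1 - z)) *
        (complex_of_real (sin (pi * z / 2)) * (\<Sum>n. A n) +
         complex_of_real (cos (pi * z / 2)) * (\<Sum>n. B n)) \<and>
    (LINT q:{0..1}|lebesgue. f w q * hurwitz_zeta (complex_of_real z) (1 - q)) =
      complex_of_real (Gamma (1 - z) / (2 * pi) powr (1 - z)) *
        (complex_of_real (sin (pi * z / 2)) * (\<Sum>n. A n) -
         complex_of_real (cos (pi * z / 2)) * (\<Sum>n. B n))"
proof -
  define \<kappa> where "\<kappa> = Gamma (1 - z) / (2 * pi) powr (1 - z)"
  define S where "S N q = (\<Sum>n<N. complex_of_real (2 * \<kappa> * hurwitz_series_term z n q))" for N q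
  have \<kappa>: "\<kappa> > 0" using z by (simp add: \<kappa>_def Gamma_real_pos)
  obtain C where C: "\<And>N q. 0 < q \<Longrightarrow> q < 1 \<Longrightarrow> \<bar>\<Sum>n<N. hurwitz_series_term z n q\<bar> \<le> C"
    using hurwitz_series_partial_sums_bounded[OF z] by blast
  have S_bound: "norm (S N q) \<le> 2 * \<kappa> * C" if "0 < q" "q < 1" for N q
  proof -
    have "S N q = complex_of_real (2 * \<kappa> * (\<Sum>n<N. hurwitz_series_term z n q))"
      unfolding S_def by (simp only: of_real_sum sum_distrib_left)
    then have "norm (S N q) = 2 * \<kappa> * \<bar>\<Sum>n<N. hurwitz_series_term z n q\<bar>"
      using \<kappa> by (simp add: abs_mult del: of_real_mult)
    then show ?thesis using C[OF that, of N] \<kappa> by simp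
  qed
  have S_lim: "(\<lambda>N. S N q) \<longlonglongrightarrow> hurwitz_zeta (complex_of_real z) q" if "0 < q" "q < 1" for q
    using hurwitz_zeta_series[OF z that] by (simp only: sums_def S_def \<kappa>_def times_divide_eq_right)
  have S_cont_UNIV: "continuous_on UNIV (S N)" for N
    unfolding S_def[abs_def] hurwitz_series_term_def
    by (intro continuous_intros)
  have S_cont: "continuous_on {0..1} (S N)" "continuous_on {0..1} (\<lambda>q. S N (1 - q))" for N
    by (auto intro!: continuous_on_compose2[OF S_cont_UNIV] continuous_intros
        continuous_on_subset[OF S_cont_UNIV])

  note first = integral_mult_bounded_limit[OF f_int, where K = S and k = "hurwitz_zeta (complex_of_real z)" and B = "2 * \<kappa> * C"]
  note second = integral_mult_bounded_limit[OF f_int, where K = "\<lambda>N q. S N (1 - q)" and k = "\<lambda>q. hurwitz_zeta (complex_of_real z) (1 - q)" and B = "2 * \<kappa> * C"]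
  have int1: "(\<lambda>q. f w q * hurwitz_zeta (complex_of_real z) q) absolutely_integrable_on {0..1}"
    using S_lim S_bound S_cont by (intro first) auto
  have int2: "(\<lambda>q. f w q * hurwitz_zeta (complex_of_real z) (1 - q)) absolutely_integrable_on {0..1}"
    using S_lim S_bound S_cont by (intro second) auto
  have partial_sum: "(LINT q:{0..1}|lebesgue. f w q * (\<Sum>n<N. complex_of_real (2 * \<kappa> * (real (Suc n) powr (z - 1) *
            (s * cos (2 * pi * q * real (Suc n)) + t * sin (2 * pi * q * real (Suc n))))))) =
    of_real \<kappa> * (of_real s * (\<Sum>n<N. a (Suc n) w / of_real (real (Suc n) powr (1 - z))) +
                  of_real t * (\<Sum>n<N. b (Suc n) w / of_real (real (Suc n) powr (1 - z))))" for N s t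
    by (rule integral_mult_trigonometric_sum[OF f_int a b])
  have lim1: "(\<lambda>N. of_real \<kappa> * (of_real (sin (pi * z / 2)) * (\<Sum>n<N. A n) + of_real (cos (pi * z / 2)) * (\<Sum>n<N. B n)))
      \<longlonglongrightarrow> (LINT q:{0..1}|lebesgue. f w q * hurwitz_zeta (complex_of_real z) q)"
  proof -
    have "(\<lambda>N. LINT q:{0..1}|lebesgue. f w q * S N q) \<longlonglongrightarrow> (LINT q:{0..1}|lebesgue. f w q * hurwitz_zeta (complex_of_real z) q)"
      using S_lim S_bound S_cont by (intro first) auto
    then show ?thesis
      unfolding S_def hurwitz_series_term_def A_def B_def
        partial_sum .
  qed
  have lim2: "(\<lambda>N. of_real \<kappa> * (of_real (sin (pi * z / 2)) * (\<Sum>n<N. A n) + of_real (- cos (pi * z / 2)) * (\<Sum>n<N. B n)))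
      \<longlonglongrightarrow> (LINT q:{0..1}|lebesgue. f w q * hurwitz_zeta (complex_of_real z) (1 - q))"
  proof -
    have "(\<lambda>N. LINT q:{0..1}|lebesgue. f w q * S N (1 - q)) \<longlonglongrightarrow> (LINT q:{0..1}|lebesgue. f w q * hurwitz_zeta (complex_of_real z) (1 - q))"
      using S_lim S_bound S_cont by (intro second) auto
    then show ?thesis
      unfolding S_def hurwitz_series_term_reflect A_def B_def
        partial_sum .
  qed

  define I where "I = integral {0..1} (\<lambda>q. norm (f w q))"
  have norm_a: "norm (a n w) \<le> 2 * I" if "n \<ge> 1" for n
    using norm_set_integral_mult_le[OF f_int, of "\<lambda>q. cos (2 * pi * q * real n)"]
    by (simp add: a[OF that] norm_mult I_def continuous_intros)
  have norm_b: "norm (b n w) \<le> 2 * I" if "n \<ge> 1" for n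
    using norm_set_integral_mult_le[OF f_int, of "\<lambda>q. sin (2 * pi * q * real n)"]
    by (simp add: b[OF that] norm_mult I_def continuous_intros)
  have A: "summable A" if "z < 0"
    unfolding A_def using norm_a that by (rule summable_div_Suc_powr)
  have B: "summable B"
  proof (cases "z = 0")
    case True
    \<comment> \<open>Here boundedness of the coefficients is too weak. Since the sine factor
      vanishes, \<open>lim1\<close> itself says that \<kappa> times the partial sums of
      \<open>B\<close> converges, and \<kappa> is nonzero.\<close>
    have "(\<lambda>N. of_real \<kappa> * (\<Sum>n<N. B n)) \<longlonglongrightarrow> (LINT q:{0..1}|lebesgue. f w q * hurwitz_zeta (complex_of_real z) q)"
      using lim1 by (simp add: True)
    from tendsto_mult[OF tendsto_const[of "inverse (of_real \<kappa>)"] this] show ?thesis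
      using \<kappa> by (auto simp: summable_iff_convergent convergent_def mult.assoc[symmetric])
  next
    case False
    then show ?thesis
      unfolding B_def using norm_b z by (intro summable_div_Suc_powr[of "\<lambda>n. b n w"]) auto
  qed
  \<comment> \<open>For z = 0 both sides are 0, whatever value the infinite sum takes.\<close>
  have A_lim: "(\<lambda>N. complex_of_real (sin (pi * z / 2)) * (\<Sum>n<N. A n)) \<longlonglongrightarrow> complex_of_real (sin (pi * z / 2)) * (\<Sum>n. A n)"
  proof (cases "z = 0")
    case False
    then show ?thesis using A z by (intro tendsto_mult tendsto_const summable_LIMSEQ) auto
  qed simp
  \<comment> \<open>The first formula takes t = cos (pi z / 2), the second its negative.\<close>
  have "(\<lambda>N. of_real \<kappa> * (of_real (sin (pi * z / 2)) * (\<Sum>n<N. A n) + of_real t * (\<Sum>n<N. B n)))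
      \<longlonglongrightarrow> of_real \<kappa> * (of_real (sin (pi * z / 2)) * (\<Sum>n. A n) + complex_of_real t * (\<Sum>n. B n))" for t
    by (intro tendsto_mult[OF tendsto_const] tendsto_add A_lim summable_LIMSEQ B)
  from LIMSEQ_unique[OF lim1 this] LIMSEQ_unique[OF lim2 this] show ?thesis
    using A B int1 int2 by (simp add: \<kappa>_def)
qed

end
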